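(* Let $a\in(0,1]$ and let $\theta\in C^1([0,\infty))$ be such that $\operatorname{supp}\theta'$ is compact in $\mathbb{R}$ and $\theta'$ is not identically zero. Then there exists a constant $c>0$ such that for all $u\in H_0^1(\Omega)$, $$\int_\Omega|\nabla u(x)|^2\,dx-\frac1{4a^2}\int_\Omega\frac{|u(x)|^2}{|x|^2}\,dx\ \ge\ c\int_\Omega\frac{|u(x)|^2}{1+|x|^2\log^2(|x|)}\,dx.$$
   Context: For $\theta:(0,\infty)\to\mathbb{R}$ (here the restriction of a $C^1$ function on $[0,\infty)$) and $a\in(0,1]$, the curved wedge is $\Omega:=\{(r\cos[\varphi+\theta(r)],\,r\sin[\varphi+\theta(r)]) : r\in(0,\infty),\ \varphi\in(0,2\pi a)\}\subset\mathbb{R}^2$. *)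

theory Defs
  imports "HOL-Analysis.Analysis"
begin

definition curved_wedge :: "real \<Rightarrow> (real \<Rightarrow> real) \<Rightarrow> (real \<times> real) set" where
  "curved_wedge a \<theta> = {(r * cos (\<phi> + \<theta> r), r * sin (\<phi> + \<theta> r)) | r \<phi>.
      0 < r \<and> 0 < \<phi> \<and> \<phi> < 2 * pi * a}"

definition pderiv_dir :: "'a::euclidean_space \<Rightarrow> ('a \<Rightarrow> real) \<Rightarrow> 'a \<Rightarrow> real" where
  "pderiv_dir v f = (\<lambda>x. frechet_derivative f (at x) v)"

definition grad :: "('a::euclidean_space \<Rightarrow> real) \<Rightarrow> 'a \<Rightarrow> 'a" where
  "grad f x = (\<Sum>b\<in>Basis. frechet_derivative f (at x) b *\<^sub>R b)"

definition smooth_on :: "'a::euclidean_space set \<Rightarrow> ('a \<Rightarrow> real) \<Rightarrow> bool" where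
  "smooth_on U f \<longleftrightarrow> (\<forall>vs. set vs \<subseteq> Basis \<longrightarrow> foldr pderiv_dir vs f differentiable_on U)"

definition tsupport :: "('a::topological_space \<Rightarrow> real) \<Rightarrow> 'a set" where
  "tsupport f = closure {x. f x \<noteq> 0}"

definition test_fun :: "'a::euclidean_space set \<Rightarrow> ('a \<Rightarrow> real) \<Rightarrow> bool" where
  "test_fun \<Omega> \<phi> \<longleftrightarrow> smooth_on UNIV \<phi> \<and> compact (tsupport \<phi>) \<and> tsupport \<phi> \<subseteq> \<Omega>"

text \<open>H_0^1(Omega): closure of C_c^infinity(Omega) in the H^1 norm.
  H01 Omega u g means u is in H_0^1(Omega) with (weak) gradient g: there are
  test functions converging to u in L^2 whose gradients converge to g in L^2.
  (u and g are extended by zero outside Omega.)\<close>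
definition H01 :: "'a::euclidean_space set \<Rightarrow> ('a \<Rightarrow> real) \<Rightarrow> ('a \<Rightarrow> 'a) \<Rightarrow> bool" where
  "H01 \<Omega> u g \<longleftrightarrow> u \<in> borel_measurable lborel \<and> g \<in> borel_measurable lborel \<and>
     (\<exists>\<phi>. (\<forall>n. test_fun \<Omega> (\<phi> n)) \<and>
        ((\<lambda>n. \<integral>\<^sup>+ x. ennreal ((\<phi> n x - u x)\<^sup>2) \<partial>lborel) \<longlongrightarrow> 0) sequentially \<and>
        ((\<lambda>n. \<integral>\<^sup>+ x. ennreal ((norm (grad (\<phi> n) x - g x))\<^sup>2) \<partial>lborel) \<longlongrightarrow> 0) sequentially)"

end

theory Submission
  imports Defs
begin

text \<open>In the twisted polar coordinates $v(r,\varphi) = u(r e^{i(\varphi+\theta(r))})$ the Dirichlet form is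
  $\int\!\int \bigl[(v_r - \theta' v_\varphi)^2 + v_\varphi^2/r^2\bigr]\, r\,dr\,d\varphi$. Completing the square against a vector field
  $(F_1, F_2) = (f_1, f_2)/r$ and integrating by parts bounds it below by $\int\!\int v^2 Z\, r\,dr\,d\varphi$, where
  $r^2 Z = r\,\partial_r f_1 - r\theta'\partial_\varphi f_1 + \partial_\varphi f_2 - f_1^2 - f_2^2$; only $\theta'$, never $\theta''$, enters.
  With $k = 1/(2a)$ the field $f_1 = 0$, $f_2 = -k\cot k\varphi$ gives $Z = k^2/r^2$ exactly. Perturb it to
  $f_1 = \epsilon(G(r) \sin k\varphi\cos k\varphi + q(r))$, $f_2 = -k\cot k\varphi + \epsilon m$, with $G$ a bump supported where $\theta'$
  does not vanish and $m$ chosen to cancel the angular dependence at first order in $\epsilon$. The gain becomes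
  $\epsilon\,(r q' + k r\theta' G/2) - O(\epsilon^2)$. With $s = (\ln r - t_0)/\delta$ the choice $q = -s/(1+s^2)$ makes $r q'$ comparable to
  $1/(1+s^2)$, i.e. to $1/\ln^2 r$, away from $|s| \le 1$, and there $\theta' G$ compensates its negative sign.\<close>

subsection \<open>Change of variables in the plane\<close>

text \<open>Without twist the Hardy bound is critical: a radial q that tends to 0 at both ends of
  the logarithmic axis has r q' of integral zero in ln r, so r q' must be negative somewhere. The
  twist has to pay for that. At first order in \<epsilon> only the angular mean with weight sin(k
  \<phi>)^2 counts, because the linear equation for m has a bounded solution only if its right side
  has mean zero in this sense. The twist term is -k r \<theta>' G cos(2 k \<phi>), and -cos(2 k
  \<phi>) has weighted mean 1/2; this is the source of k r \<theta>' G / 2. The term with G' carries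
  sin(k \<phi>) cos(k \<phi>), whose weighted mean is zero, so the slopes of the bump cost nothing
  at first order. The second-order losses are squares that decay like 1/(1 + s^2), exactly as the
  gain does, so one small \<epsilon> works for all r.\<close>

definition vec2_pair :: "real^2 \<Rightarrow> real \<times> real" where "vec2_pair v = (v $ 1, v $ 2)"
definition pair_vec2 :: "real \<times> real \<Rightarrow> real^2" where "pair_vec2 p = vector [fst p, snd p]"

lemma vec2_pair_inverse [simp]: "vec2_pair (pair_vec2 p) = p" "pair_vec2 (vec2_pair v) = v"
  by (auto simp: vec2_pair_def pair_vec2_def vector_2 vec_eq_iff forall_2)

lemma linear_vec2_pair: "linear vec2_pair"
  by (auto simp: vec2_pair_def intro!: linearI)

lemma linear_pair_vec2: "linear pair_vec2"
  by (auto simp: pair_vec2_def vec_eq_iff forall_2 vector_2 intro!: linearI)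

lemma measurable_vec2_pair [measurable]: "vec2_pair \<in> borel_measurable borel"
  by (intro borel_measurable_continuous_onI linear_continuous_on linear_conv_bounded_linear[THEN iffD1] linear_vec2_pair)

text \<open>It suffices to compare boxes, and the preimage of a box is a box with the same two side
  lengths. This moves integrals between \<open>real^2\<close>, where Jacobians are determinants of
  matrices, and \<open>real \<times> real\<close>, where the wedge lives.\<close>

lemma lborel_distr_vec2_pair: "distr lborel borel vec2_pair = lborel"
proof (rule lborel_eqI[symmetric])
  fix l u :: "real \<times> real"
  assume lu: "\<And>b. b \<in> Basis \<Longrightarrow> l \<bullet> b \<le> u \<bullet> b"
  have le: "fst l \<le> fst u" "snd l \<le> snd u"
    using lu[of "(1,0)"] lu[of "(0,1)"] by (auto simp: inner_prod_def Basis_prod_def)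
  have "vec2_pair -` box l u = box (pair_vec2 l) (pair_vec2 u)"
  proof -
    have "box l u = {p. fst l < fst p \<and> fst p < fst u \<and> snd l < snd p \<and> snd p < snd u}"
      by (cases l; cases u) (auto simp: box_def Basis_prod_def)
    moreover have "box (pair_vec2 l) (pair_vec2 u) = {v. fst l < v $ 1 \<and> v $ 1 < fst u \<and> snd l < v $ 2 \<and> v $ 2 < snd u}"
      by (simp add: set_eq_iff mem_box_cart forall_2 pair_vec2_def)
    ultimately show ?thesis
      by (simp add: vec2_pair_def vimage_def)
  qed
  moreover have "emeasure lborel (box (pair_vec2 l) (pair_vec2 u)) = (\<Prod>b\<in>Basis. (u - l) \<bullet> b)"
  proof -
    have "(\<Prod>b\<in>Basis. (pair_vec2 u - pair_vec2 l) \<bullet> b) = (fst u - fst l) * (snd u - snd l)"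
      by (simp add: Basis_vec_def prod.UNION_disjoint UNIV_2 axis_eq_axis inner_axis pair_vec2_def vector_2)
    moreover have "(\<Prod>b\<in>Basis. (u - l) \<bullet> b) = (fst u - fst l) * (snd u - snd l)"
      by (simp add: Basis_prod_def inner_prod_def prod.union_disjoint)
    moreover have "\<forall>b\<in>Basis. pair_vec2 l \<bullet> b \<le> pair_vec2 u \<bullet> b"
      using le by (auto simp: Basis_vec_def inner_axis pair_vec2_def UNIV_2 vector_2)
    ultimately show ?thesis by (simp add: emeasure_lborel_box_eq)
  qed
  ultimately show "emeasure (distr lborel borel vec2_pair) (box l u) = (\<Prod>b\<in>Basis. (u - l) \<bullet> b)"
    by (simp add: emeasure_distr)
qed simp

lemma nn_integral_vec2_pair:
  assumes "f \<in> borel_measurable borel"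
  shows "(\<integral>\<^sup>+ v. f (vec2_pair v) \<partial>lborel) = (\<integral>\<^sup>+ p. f p \<partial>lborel)"
  using assms by (subst lborel_distr_vec2_pair[symmetric], subst nn_integral_distr) auto

text \<open>The substitution is performed in \<open>real^2\<close> and carried back by
  \<open>vec2_pair\<close>. Compactness of \<open>D\<close> and continuity make both integrands
  integrable, so the equality of real integrals lifts to nonnegative ones. Writing the derivative
  through four coefficients turns the Jacobian into an explicit 2 by 2 determinant.\<close>

lemma nn_integral_change_of_variables_pair:
  fixes g :: "real \<times> real \<Rightarrow> real \<times> real" and f :: "real \<times> real \<Rightarrow> real"
  assumes D: "compact D"
    and der: "\<And>p. p \<in> D \<Longrightarrow> (g has_derivative (\<lambda>h. (A p * fst h + B p * snd h, C p * fst h + E p * snd h))) (at p within D)"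
    and inj: "inj_on g D"
    and f: "continuous_on (g ` D) f" "\<And>p. 0 \<le> f p"
    and cont: "continuous_on D (\<lambda>p. A p * E p - B p * C p)"
  shows "(\<integral>\<^sup>+ p\<in>g ` D. ennreal (f p) \<partial>lborel) = (\<integral>\<^sup>+ p\<in>D. ennreal (\<bar>A p * E p - B p * C p\<bar> * f (g p)) \<partial>lborel)"
proof -
  define D2 where "D2 = pair_vec2 ` D"
  define g2 where "g2 = pair_vec2 \<circ> g \<circ> vec2_pair"
  define g2' where "g2' v = pair_vec2 \<circ> (\<lambda>h. (A (vec2_pair v) * fst h + B (vec2_pair v) * snd h, C (vec2_pair v) * fst h + E (vec2_pair v) * snd h)) \<circ> vec2_pair" for v
  have blp: "bounded_linear pair_vec2" and blv: "bounded_linear vec2_pair"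
    using linear_pair_vec2 linear_vec2_pair linear_conv_bounded_linear by blast+
  have cp: "continuous_on S pair_vec2" for S by (simp add: blp linear_continuous_on)
  have cv: "continuous_on S vec2_pair" for S by (simp add: blv linear_continuous_on)
  have mem_vec2: "v \<in> pair_vec2 ` T \<longleftrightarrow> vec2_pair v \<in> T" for v T
    by (metis image_iff vec2_pair_inverse)
  have D2: "compact D2" unfolding D2_def by (intro compact_continuous_image cp D)
  have vD2: "vec2_pair ` D2 = D" by (force simp: D2_def image_image)
  have im: "g2 ` D2 = pair_vec2 ` (g ` D)" by (auto simp: g2_def D2_def image_image)
  have gc: "continuous_on D g" using der by (rule has_derivative_continuous_on)
  have cgD: "compact (g ` D)" by (intro compact_continuous_image gc D)
  have cgD2: "compact (g2 ` D2)" unfolding im by (intro compact_continuous_image cp cgD)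
  have det: "det (matrix (g2' v)) = A (vec2_pair v) * E (vec2_pair v) - B (vec2_pair v) * C (vec2_pair v)" for v
    by (simp add: det_2 matrix_def g2'_def vec2_pair_def pair_vec2_def axis_def vector_2)
  have der2: "(g2 has_derivative g2' v) (at v within D2)" if "v \<in> D2" for v
  proof -
    have "vec2_pair v \<in> D" using that vD2 by blast
    from der[OF this] vD2 have "(g has_derivative (\<lambda>h. (A (vec2_pair v) * fst h + B (vec2_pair v) * snd h, C (vec2_pair v) * fst h + E (vec2_pair v) * snd h))) (at (vec2_pair v) within vec2_pair ` D2)" by simp
    moreover have "(vec2_pair has_derivative vec2_pair) (at v within D2)"
      by (rule bounded_linear_imp_has_derivative[OF blv])
    ultimately have 1: "((\<lambda>v. g (vec2_pair v)) has_derivative (\<lambda>h. (\<lambda>h. (A (vec2_pair v) * fst h + B (vec2_pair v) * snd h, C (vec2_pair v) * fst h + E (vec2_pair v) * snd h)) (vec2_pair h))) (at v within D2)"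
      by (rule has_derivative_in_compose[rotated])
    show ?thesis unfolding g2_def g2'_def o_def
      by (rule bounded_linear.has_derivative[OF blp 1])
  qed
  have inj2: "inj_on g2 D2"
    using inj unfolding g2_def D2_def inj_on_def by (metis (no_types, lifting) comp_apply imageE vec2_pair_inverse(1))
  have ai: "h absolutely_integrable_on S" if "compact S" "continuous_on S h" for S and h :: "real^2 \<Rightarrow> real"
  proof -
    have "integrable lborel (\<lambda>x. indicator S x *\<^sub>R h x)"
      by (rule borel_integrable_compact[OF that])
    then show ?thesis unfolding set_integrable_def by (simp add: integrable_completion borel_measurable_integrable)
  qed
  define h where "h v = f (vec2_pair v)" for v
  define d where "d p = \<bar>A p * E p - B p * C p\<bar> * f (g p)" for p
  have h0: "0 \<le> h v" and d0: "0 \<le> d p" for v p by (simp_all add: h_def d_def f(2))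
  have ch: "continuous_on (g2 ` D2) h" unfolding h_def
    by (rule continuous_on_compose2[OF f(1) cv]) (auto simp: im)
  have cd: "continuous_on D d" unfolding d_def
    by (intro continuous_intros cont continuous_on_compose2[OF f(1) gc]) auto
  have cd2: "continuous_on D2 (\<lambda>v. d (vec2_pair v))"
    by (rule continuous_on_compose2[OF cd cv]) (simp add: vD2)
  have ih: "h absolutely_integrable_on (g2 ` D2)" by (rule ai[OF cgD2 ch])
  have id: "(\<lambda>v. d (vec2_pair v)) absolutely_integrable_on D2" by (rule ai[OF D2 cd2])
  have deq: "d (vec2_pair v) = \<bar>det (matrix (g2' v))\<bar> * h (g2 v)" for v
    by (simp add: d_def det h_def g2_def)
  \<comment> \<open>The substitution theorem is about vector-valued integrands, so the scalar
    \<open>h\<close> is embedded into \<open>real^1\<close> by \<open>vec\<close>. The equivalence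
    is read from right to left, starting from the integrability of \<open>h\<close> on the
    image.\<close>
  have "(\<lambda>v. \<bar>det (matrix (g2' v))\<bar> *\<^sub>R (vec (h (g2 v)) :: real^1)) absolutely_integrable_on D2 \<and>
           integral D2 (\<lambda>v. \<bar>det (matrix (g2' v))\<bar> *\<^sub>R vec (h (g2 v))) = (vec (integral (g2 ` D2) h) :: real^1)
         \<longleftrightarrow> (\<lambda>v. vec (h v) :: real^1) absolutely_integrable_on (g2 ` D2) \<and>
           integral (g2 ` D2) (\<lambda>v. vec (h v)) = (vec (integral (g2 ` D2) h) :: real^1)"
    by (rule has_absolute_integral_change_of_variables_compact[OF D2 der2 inj2])
  then have eq: "integral D2 (\<lambda>v. d (vec2_pair v)) = integral (g2 ` D2) h"
    using ih by (simp add: absolutely_integrable_on_1_iff integral_on_1_eq deq)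
  have bor: "(\<lambda>x. ennreal (k x) * indicator S x) \<in> borel_measurable borel"
    if "compact S" "continuous_on S k" for S and k :: "real \<times> real \<Rightarrow> real"
  proof -
    have "(\<lambda>x. ennreal (indicator S x *\<^sub>R k x)) \<in> borel_measurable borel"
      using borel_measurable_continuous_on_indicator[OF _ that(2)] compact_imp_closed[OF that(1)]
      by (auto intro!: measurable_compose[OF _ measurable_ennreal])
    also have "(\<lambda>x. ennreal (indicator S x *\<^sub>R k x)) = (\<lambda>x. ennreal (k x) * indicator S x)"
      by (auto simp: indicator_def)
    finally show ?thesis .
  qed
  have "(\<integral>\<^sup>+ p\<in>g ` D. ennreal (f p) \<partial>lborel) = (\<integral>\<^sup>+ v. ennreal (f (vec2_pair v)) * indicator (g ` D) (vec2_pair v) \<partial>lborel)"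
    by (rule nn_integral_vec2_pair[OF bor[OF cgD f(1)], symmetric])
  also have "\<dots> = (\<integral>\<^sup>+ v\<in>g2 ` D2. ennreal (h v) \<partial>lborel)"
    by (intro nn_integral_cong) (simp add: h_def indicator_def im mem_vec2)
  also have "\<dots> = ennreal (integral (g2 ` D2) h)"
    using ih h0 by (intro nn_integral_has_integral_lebesgue')
      (auto simp: absolutely_integrable_on_def integrable_integral)
  also have "\<dots> = ennreal (integral D2 (\<lambda>v. d (vec2_pair v)))" using eq by simp
  also have "\<dots> = (\<integral>\<^sup>+ v\<in>D2. ennreal (d (vec2_pair v)) \<partial>lborel)"
    using id d0 by (intro nn_integral_has_integral_lebesgue'[symmetric])
      (auto simp: absolutely_integrable_on_def integrable_integral)
  also have "\<dots> = (\<integral>\<^sup>+ v. ennreal (d (vec2_pair v)) * indicator D (vec2_pair v) \<partial>lborel)"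
    by (intro nn_integral_cong) (simp add: D2_def indicator_def mem_vec2)
  also have "\<dots> = (\<integral>\<^sup>+ p\<in>D. ennreal (d p) \<partial>lborel)"
    by (rule nn_integral_vec2_pair[OF bor[OF D cd]])
  finally show ?thesis by (simp add: d_def)
qed

subsection \<open>The calibrating vector field\<close>

text \<open>The positive part is squared to make the function C^1 across \<bar>s\<bar> = 3. One
  derivative is enough: \<open>bump'\<close> also enters the second component of the field, but that
  component is differentiated only in the angle.\<close>

definition bump :: "real \<Rightarrow> real" where "bump s = (max 0 (9 - s\<^sup>2))\<^sup>2"
definition bump' :: "real \<Rightarrow> real" where "bump' s = - 4 * s * max 0 (9 - s\<^sup>2)"

lemma has_real_derivative_max_power2: "((\<lambda>x::real. (max 0 x)\<^sup>2) has_real_derivative 2 * max 0 x) (at x)"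
proof -
  consider "x < 0" | "x = 0" | "x > 0" by linarith
  then show ?thesis
  proof cases
    case 1
    have "((\<lambda>x::real. 0) has_real_derivative 0) (at x)" by simp
    then have "((\<lambda>x::real. (max 0 x)\<^sup>2) has_real_derivative 0) (at x)"
      by (rule has_field_derivative_transform_within_open[where S = "{..<0}"]) (use 1 in auto)
    then show ?thesis using 1 by simp
  next
    case 3
    have "((\<lambda>x::real. x\<^sup>2) has_real_derivative 2 * x) (at x)" by (auto intro!: derivative_eq_intros)
    then have "((\<lambda>x::real. (max 0 x)\<^sup>2) has_real_derivative 2 * x) (at x)"
      by (rule has_field_derivative_transform_within_open[where S = "{0<..}"]) (use 3 in auto)
    then show ?thesis using 3 by simp
  next
    case 2
    have "((\<lambda>h::real. (max 0 h)\<^sup>2 / h) \<longlongrightarrow> 0) (at 0)"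
    proof (rule Lim_null_comparison[where g = "\<lambda>h. \<bar>h\<bar>"])
      show "\<forall>\<^sub>F h::real in at 0. norm ((max 0 h)\<^sup>2 / h) \<le> \<bar>h\<bar>"
        by (intro always_eventually allI) (auto simp: max_def power2_eq_square)
      show "((\<lambda>h::real. \<bar>h\<bar>) \<longlongrightarrow> 0) (at 0)"
        by (intro tendsto_eq_intros) auto
    qed
    then show ?thesis using 2 by (simp add: DERIV_def)
  qed
qed

lemma bump_deriv: "(bump has_real_derivative bump' s) (at s)"
proof -
  have "((\<lambda>s. (max 0 (9 - s\<^sup>2))\<^sup>2) has_real_derivative 2 * max 0 (9 - s\<^sup>2) * (- 2 * s)) (at s)"
    by (rule DERIV_chain2[OF has_real_derivative_max_power2]) (auto intro!: derivative_eq_intros)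
  then show ?thesis by (simp add: bump_def[abs_def] bump'_def algebra_simps)
qed

lemma bump_zero: "\<not> \<bar>s\<bar> < 3 \<Longrightarrow> bump s = 0" "\<not> \<bar>s\<bar> < 3 \<Longrightarrow> bump' s = 0"
proof -
  assume "\<not> \<bar>s\<bar> < 3"
  then have "9 \<le> s\<^sup>2" using abs_le_square_iff[of 3 s] by simp
  then show "bump s = 0" "bump' s = 0" by (auto simp: bump_def bump'_def)
qed

lemma bump_nonneg: "0 \<le> bump s" by (simp add: bump_def)

lemma bump_ge: "\<bar>s\<bar> \<le> 2 \<Longrightarrow> 1 \<le> bump s"
proof -
  assume "\<bar>s\<bar> \<le> 2"
  then have "s\<^sup>2 \<le> 4" using abs_le_square_iff[of s 2] by simp
  then have "1 \<le> max 0 (9 - s\<^sup>2)" by simp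
  then show ?thesis unfolding bump_def by (rule one_le_power)
qed

text \<open>Any bounded function supported in \<bar>s\<bar> \<le> 3 obeys such a bound, since 1 +
  s^2 \<le> 10 there. The form 1/(1 + s^2) is the one in which second-order errors are compared with
  the gain. The actual constants are 65610 and 116640; 10^6 is a common round value.\<close>

lemma bump_bounds: "(bump s)\<^sup>2 \<le> 10^6 / (1 + s\<^sup>2)" "(bump' s)\<^sup>2 \<le> 10^6 / (1 + s\<^sup>2)"
proof -
  have *: "(bump s)\<^sup>2 * (1 + s\<^sup>2) \<le> 10^6 \<and> (bump' s)\<^sup>2 * (1 + s\<^sup>2) \<le> 10^6"
  proof (cases "\<bar>s\<bar> < 3")
    case False then show ?thesis by (simp add: bump_zero)
  next
    case True
    then have s: "s\<^sup>2 \<le> 9" using abs_le_square_iff[of s 3] by simp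
    have m: "0 \<le> max 0 (9 - s\<^sup>2)" "max 0 (9 - s\<^sup>2) \<le> 9" by auto
    have "bump s \<le> 9\<^sup>2" unfolding bump_def by (rule power_mono[OF m(2,1)])
    then have "(bump s)\<^sup>2 \<le> (9\<^sup>2)\<^sup>2" by (rule power_mono) (rule bump_nonneg)
    then have 1: "(bump s)\<^sup>2 * (1 + s\<^sup>2) \<le> (9\<^sup>2)\<^sup>2 * 10" by (rule mult_mono) (use s in auto)
    have "(bump' s)\<^sup>2 = 16 * s\<^sup>2 * (max 0 (9 - s\<^sup>2))\<^sup>2" by (simp add: bump'_def power_mult_distrib)
    also have "\<dots> \<le> 16 * 9 * 9\<^sup>2" by (intro mult_mono power_mono m) (use s in auto)
    finally have 2: "(bump' s)\<^sup>2 * (1 + s\<^sup>2) \<le> (16 * 9 * 9\<^sup>2) * 10" by (rule mult_mono) (use s in auto)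
    from 1 2 show ?thesis by simp
  qed
  have "0 < 1 + s\<^sup>2" by (simp add: add_pos_nonneg)
  with * show "(bump s)\<^sup>2 \<le> 10^6 / (1 + s\<^sup>2)" "(bump' s)\<^sup>2 \<le> 10^6 / (1 + s\<^sup>2)"
    by (simp_all add: pos_le_divide_eq)
qed

text \<open>In s = (ln r - t0)/\<delta>, the field \<epsilon> \<open>slope\<close> belongs to the
  radial factor (1 + s^2)^(\<epsilon> \<delta> / 2): it is minus its logarithmic derivative in ln r.
  For small \<epsilon> this factor is concave in s far out, where it yields a gain of order 1/s^2,
  and convex near s = 0, where the gain is negative.\<close>

definition slope :: "real \<Rightarrow> real" where "slope s = - s / (1 + s\<^sup>2)"
definition slope' :: "real \<Rightarrow> real" where "slope' s = (s\<^sup>2 - 1) / (1 + s\<^sup>2)\<^sup>2"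

lemma slope_deriv: "(slope has_real_derivative slope' s) (at s)"
proof -
  have "1 + s\<^sup>2 \<noteq> 0" by (smt (verit) zero_le_power2)
  then have "((\<lambda>s. - s / (1 + s\<^sup>2)) has_real_derivative (- 1 * (1 + s\<^sup>2) - - s * (2 * s)) / ((1 + s\<^sup>2) * (1 + s\<^sup>2))) (at s)"
    by (intro DERIV_divide) (auto intro!: derivative_eq_intros)
  moreover have "- 1 * (1 + s\<^sup>2) - - s * (2 * s) = s\<^sup>2 - 1" by (simp add: power2_eq_square)
  ultimately show ?thesis unfolding slope_def[abs_def] slope'_def by (simp add: power2_eq_square)
qed

lemma slope_bound: "(slope s)\<^sup>2 \<le> 1 / (1 + s\<^sup>2)"
proof -
  have "0 < 1 + s\<^sup>2" by (simp add: add_pos_nonneg)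
  then show ?thesis by (simp add: slope_def power_divide divide_simps power2_eq_square)
qed

text \<open>The quotient (s^2 - 1)/(s^2 + 1) is at least -1 everywhere and at least 3/5 once s^2
  \<ge> 4. Asking for \<bar>s\<bar> \<ge> 2 instead of \<bar>s\<bar> > 1 buys a uniform positive
  constant.\<close>

lemma slope'_bounds: "- 1 / (1 + s\<^sup>2) \<le> slope' s" "2 \<le> \<bar>s\<bar> \<Longrightarrow> 3 / 5 / (1 + s\<^sup>2) \<le> slope' s"
proof -
  have p: "0 < 1 + s\<^sup>2" by (simp add: add_pos_nonneg)
  have q: "slope' s = (s\<^sup>2 - 1) / (1 + s\<^sup>2) / (1 + s\<^sup>2)" by (simp add: slope'_def power2_eq_square)
  show "- 1 / (1 + s\<^sup>2) \<le> slope' s"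
    unfolding q by (rule divide_right_mono) (use p in \<open>simp_all add: divide_simps\<close>)
  assume "2 \<le> \<bar>s\<bar>"
  then have "4 \<le> s\<^sup>2" using abs_le_square_iff[of 2 s] by simp
  then show "3 / 5 / (1 + s\<^sup>2) \<le> slope' s"
    unfolding q by (intro divide_right_mono) (use p in \<open>simp_all add: divide_simps\<close>)
qed

text \<open>After multiplying out, r^2 (1 + s^2) is at most a combination of r^2 and r^2 ln(r)^2,
  and both are dominated by 1 + r^2 ln(r)^2. This converts the gain, natural in s, into the weight
  of the theorem, whatever the centre \<open>t0\<close> and the scale
  \<open>\<delta>\<close>.\<close>

lemma log_weight_bound:
  fixes r t0 \<delta> :: real
  assumes "0 < r" "0 < \<delta>"
  shows "r\<^sup>2 / (1 + r\<^sup>2 * (ln r)\<^sup>2) \<le> (9 * (1 + 2 * t0\<^sup>2 / \<delta>\<^sup>2) + 2 / \<delta>\<^sup>2) / (1 + ((ln r - t0) / \<delta>)\<^sup>2)"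
proof -
  define t where "t = ln r"
  define w where "w = 1 + r\<^sup>2 * t\<^sup>2"
  have w: "1 \<le> w" "r\<^sup>2 * t\<^sup>2 \<le> w" by (auto simp: w_def)
  \<comment> \<open>The logarithm gives no help near r = 1, so r \<le> 3 uses the summand 1 of
    \<open>w\<close>, which costs the factor 9. Beyond 3, which is at least e, the logarithm is at
    least 1.\<close>
  have r9: "r\<^sup>2 \<le> 9 * w"
  proof (cases "r \<le> 3")
    case True
    then have "r\<^sup>2 \<le> 3\<^sup>2" using assms by (intro power_mono) auto
    then show ?thesis using w by simp
  next
    case False
    then have "exp 1 \<le> r" using exp_le by linarith
    then have "1 \<le> t" unfolding t_def using assms by (simp add: ln_ge_iff)
    then have "1 \<le> t\<^sup>2" by simp
    then have "r\<^sup>2 * 1 \<le> r\<^sup>2 * t\<^sup>2" by (rule mult_left_mono) simp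
    then show ?thesis using w by simp
  qed
  have "((t - t0) / \<delta>)\<^sup>2 \<le> 2 * t0\<^sup>2 / \<delta>\<^sup>2 + 2 / \<delta>\<^sup>2 * t\<^sup>2"
  proof -
    have "(t - t0)\<^sup>2 + (t + t0)\<^sup>2 = 2 * t0\<^sup>2 + 2 * t\<^sup>2" by (simp add: power2_eq_square algebra_simps)
    then have "(t - t0)\<^sup>2 \<le> 2 * t0\<^sup>2 + 2 * t\<^sup>2" using zero_le_power2[of "t + t0"] by linarith
    then have "(t - t0)\<^sup>2 / \<delta>\<^sup>2 \<le> (2 * t0\<^sup>2 + 2 * t\<^sup>2) / \<delta>\<^sup>2" by (rule divide_right_mono) simp
    then show ?thesis by (simp add: power_divide add_divide_distrib)
  qed
  then have "r\<^sup>2 * (1 + ((t - t0) / \<delta>)\<^sup>2) \<le> r\<^sup>2 * (1 + (2 * t0\<^sup>2 / \<delta>\<^sup>2 + 2 / \<delta>\<^sup>2 * t\<^sup>2))"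
    by (intro mult_left_mono) auto
  also have "\<dots> = r\<^sup>2 * (1 + 2 * t0\<^sup>2 / \<delta>\<^sup>2) + 2 / \<delta>\<^sup>2 * (r\<^sup>2 * t\<^sup>2)"
    by (simp add: algebra_simps)
  also have "\<dots> \<le> 9 * w * (1 + 2 * t0\<^sup>2 / \<delta>\<^sup>2) + 2 / \<delta>\<^sup>2 * w"
    by (intro add_mono mult_right_mono mult_left_mono r9 w) auto
  also have "\<dots> = (9 * (1 + 2 * t0\<^sup>2 / \<delta>\<^sup>2) + 2 / \<delta>\<^sup>2) * w" by (simp add: algebra_simps)
  finally have "r\<^sup>2 * (1 + ((t - t0) / \<delta>)\<^sup>2) \<le> (9 * (1 + 2 * t0\<^sup>2 / \<delta>\<^sup>2) + 2 / \<delta>\<^sup>2) * w" .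
  moreover have "0 < 1 + ((t - t0) / \<delta>)\<^sup>2" "0 < w" using w by (auto simp: add_pos_nonneg)
  ultimately have "r\<^sup>2 / w \<le> (9 * (1 + 2 * t0\<^sup>2 / \<delta>\<^sup>2) + 2 / \<delta>\<^sup>2) / (1 + ((t - t0) / \<delta>)\<^sup>2)"
    by (simp add: pos_divide_le_eq pos_le_divide_eq mult.commute)
  then show ?thesis by (simp add: w_def t_def)
qed

text \<open>The function \<open>m\<close> solves \<open>m' + 2 k m cot(k \<phi>) = - R\<close> for the part \<open>R\<close> of the first-order gain orthogonal to \<open>sin\<^sup>2(k \<phi>)\<close>,
  so that every first-order term depending on the angle cancels.\<close>
lemma riccati_identity:
  fixes S C k T b1 P f \<epsilon> :: real
  assumes "S\<^sup>2 + C\<^sup>2 = 1" "S \<noteq> 0" "k \<noteq> 0"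
  defines "m \<equiv> T / 2 * (S * C) - b1 / (4 * k) * S\<^sup>2"
  shows "\<epsilon> * (b1 * (S * C) + P) - \<epsilon> * T * k * (C\<^sup>2 - S\<^sup>2)
     + (k\<^sup>2 / S\<^sup>2 + \<epsilon> * (T / 2 * k * (C\<^sup>2 - S\<^sup>2) - b1 / 2 * (S * C)))
     - f\<^sup>2 - (- k * (C / S) + \<epsilon> * m)\<^sup>2 = k\<^sup>2 + \<epsilon> * (P + k * T / 2) - f\<^sup>2 - \<epsilon>\<^sup>2 * m\<^sup>2"
proof -
  have cm: "C / S * m = T / 2 * C\<^sup>2 - b1 / (4 * k) * (S * C)"
    unfolding m_def using assms(2) by (simp add: field_simps power2_eq_square)
  have sq: "(- k * (C / S) + \<epsilon> * m)\<^sup>2 = k\<^sup>2 * (C\<^sup>2 / S\<^sup>2) - 2 * k * \<epsilon> * (C / S * m) + \<epsilon>\<^sup>2 * m\<^sup>2"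
  proof -
    have "(- k * y + \<epsilon> * m)\<^sup>2 = k\<^sup>2 * y\<^sup>2 - 2 * k * \<epsilon> * (y * m) + \<epsilon>\<^sup>2 * m\<^sup>2" for y
      by (simp add: power2_eq_square algebra_simps)
    from this[of "C / S"] show ?thesis by (simp only: power_divide)
  qed
  have cs: "k\<^sup>2 / S\<^sup>2 - k\<^sup>2 * (C\<^sup>2 / S\<^sup>2) = k\<^sup>2"
  proof -
    have "k\<^sup>2 / S\<^sup>2 - k\<^sup>2 * (C\<^sup>2 / S\<^sup>2) = k\<^sup>2 * ((1 - C\<^sup>2) / S\<^sup>2)" by (simp add: field_simps diff_divide_distrib)
    also have "1 - C\<^sup>2 = S\<^sup>2" using assms(1) by linarith
    finally show ?thesis using assms(2) by simp
  qed
  have k2: "2 * k * \<epsilon> * (C / S * m) = \<epsilon> * (k * T * C\<^sup>2 - b1 / 2 * (S * C))"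
    unfolding cm using assms(3) by (simp add: field_simps)
  have C2: "C\<^sup>2 = 1 - S\<^sup>2" using assms(1) by linarith
  have "\<epsilon> * (b1 * (S * C) + P) - \<epsilon> * T * k * (C\<^sup>2 - S\<^sup>2)
     + \<epsilon> * (T / 2 * k * (C\<^sup>2 - S\<^sup>2) - b1 / 2 * (S * C)) + \<epsilon> * (k * T * C\<^sup>2 - b1 / 2 * (S * C))
     = \<epsilon> * (P + k * T / 2)"
    unfolding C2 by (simp add: algebra_simps)
  with cs show ?thesis unfolding sq k2 by linarith
qed

text \<open>In the variable t = ln r the function r \<theta>'(r) is continuous and nonzero at some
  point \<open>t0\<close>, so it keeps its sign \<open>\<sigma>\<close> and stays between two
  positive bounds in absolute value on an interval around \<open>t0\<close>. The scale
  \<open>\<delta>\<close> is a third of the radius, so that the support \<bar>s\<bar> \<le> 3 of the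
  bump fits that interval.\<close>

lemma twist_anchor:
  fixes \<theta>' :: "real \<Rightarrow> real"
  assumes cont: "continuous_on {0..} \<theta>'" and nz: "\<exists>r\<ge>0. \<theta>' r \<noteq> 0"
  obtains \<delta> d \<sigma> t0 M where "0 < \<delta>" "0 < d" "\<bar>\<sigma>\<bar> = 1"
    "\<And>r. 0 < r \<Longrightarrow> \<bar>(ln r - t0) / \<delta>\<bar> < 3 \<Longrightarrow> d \<le> \<sigma> * (r * \<theta>' r) \<and> \<bar>r * \<theta>' r\<bar> \<le> M"
proof -
  \<comment> \<open>The point where \<theta>' is nonzero might be r = 0, which has no logarithm;
    continuity from the right moves it to a positive radius.\<close>
  have "\<exists>r>0. \<theta>' r \<noteq> 0"
  proof (rule ccontr)
    assume "\<not> ?thesis"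
    then have z: "\<theta>' r = 0" if "0 < r" for r using that by auto
    then have n0: "\<theta>' 0 \<noteq> 0" using nz by (metis less_eq_real_def)
    have "(\<theta>' \<longlongrightarrow> \<theta>' 0) (at 0 within {0..})" using cont by (auto simp: continuous_on_def)
    then have "(\<theta>' \<longlongrightarrow> \<theta>' 0) (at_right 0)" by (rule tendsto_within_subset) auto
    moreover have "(\<theta>' \<longlongrightarrow> 0) (at_right 0)"
      by (rule tendsto_eventually) (auto simp: eventually_at_filter z)
    ultimately show False using n0 tendsto_unique trivial_limit_at_right_real by blast
  qed
  then obtain r0 where r0: "0 < r0" "\<theta>' r0 \<noteq> 0" by auto
  define \<tau> where "\<tau> t = exp t * \<theta>' (exp t)" for t
  have ct: "continuous_on UNIV \<tau>" unfolding \<tau>_def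
    by (intro continuous_intros continuous_on_compose2[OF cont]) auto
  define t0 where "t0 = ln r0"
  have t0: "\<tau> t0 \<noteq> 0" using r0 by (simp add: \<tau>_def t0_def)
  \<comment> \<open>A deviation below half of the central value keeps the sign and confines the
    absolute value to the range from \<open>e\<close> to \<open>3 * e\<close>.\<close>
  define e where "e = \<bar>\<tau> t0\<bar> / 2"
  have e: "0 < e" using t0 by (simp add: e_def)
  from ct[THEN continuous_on_eq_continuous_at[THEN iffD1, OF open_UNIV], rule_format, of t0]
  have "isCont \<tau> t0" by simp
  then obtain h where h: "0 < h" "\<And>t. \<bar>t - t0\<bar> < h \<Longrightarrow> \<bar>\<tau> t - \<tau> t0\<bar> < e"
    using e by (auto simp: continuous_at_eps_delta dist_real_def)
  define \<delta> where "\<delta> = h / 3"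
  have \<delta>: "0 < \<delta>" using h by (simp add: \<delta>_def)
  show ?thesis
  proof (rule that[of \<delta> e "sgn (\<tau> t0)" t0 "3 * e"])
    show "\<bar>sgn (\<tau> t0)\<bar> = 1" using t0 by (simp add: abs_sgn_eq)
  next
    fix r :: real assume r: "0 < r" and "\<bar>(ln r - t0) / \<delta>\<bar> < 3"
    then have "\<bar>ln r - t0\<bar> < h" using h by (simp add: abs_divide \<delta>_def field_simps)
    from h(2)[OF this] have *: "\<bar>\<tau> (ln r) - \<tau> t0\<bar> < e" .
    have "\<tau> (ln r) = r * \<theta>' r" using r by (simp add: \<tau>_def)
    with * show "e \<le> sgn (\<tau> t0) * (r * \<theta>' r) \<and> \<bar>r * \<theta>' r\<bar> \<le> 3 * e"
      using t0 by (cases "0 < \<tau> t0") (auto simp: e_def abs_if split: if_splits)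
  qed (use \<delta> e in auto)
qed

text \<open>Everything is evaluated at one point: \<open>S\<close> and \<open>C\<close> are the sine
  and cosine of k \<phi>, \<open>b\<close> and \<open>b1\<close> the bump and its scaled derivative,
  \<open>q\<close> and \<open>P\<close> the slope and its derivative, and \<open>w\<close> is 1 +
  s^2. \<open>riccati_identity\<close> leaves the first-order gain, at least \<epsilon> \<kappa> /
  w, minus squares bounded by \<epsilon>^2 K / w with K = 2 Kb + 2 + KT + Kb1 / k^2. The condition
  on \<epsilon> lets these squares consume at most half of the gain.\<close>

lemma calibration_lower_bound:
  fixes S C k T b1 b N q \<epsilon> w M \<delta> :: real
  assumes w: "0 < w"
    and SC: "S\<^sup>2 + C\<^sup>2 = 1" "S \<noteq> 0" and k: "0 < k"
    and lin: "\<kappa> / w \<le> P + k * T / 2"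
    and b: "(N * b)\<^sup>2 \<le> Kb / w" and q: "q\<^sup>2 \<le> 1 / w" and T: "T\<^sup>2 \<le> KT / w" and b1: "b1\<^sup>2 \<le> Kb1 / w"
    and \<epsilon>: "0 < \<epsilon>" "\<epsilon> * (2 * Kb + 2 + KT + Kb1 / k\<^sup>2) \<le> \<kappa> / 2"
  shows "k\<^sup>2 + \<epsilon> * (\<kappa> / 2) / w \<le> \<epsilon> * (b1 * (S * C) + P) - \<epsilon> * T * k * (C\<^sup>2 - S\<^sup>2)
     + (k\<^sup>2 / S\<^sup>2 + \<epsilon> * (T / 2 * k * (C\<^sup>2 - S\<^sup>2) - b1 / 2 * (S * C)))
     - (\<epsilon> * (N * b * (S * C) + q))\<^sup>2 - (- k * (C / S) + \<epsilon> * (T / 2 * (S * C) - b1 / (4 * k) * S\<^sup>2))\<^sup>2"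
proof -
  have two: "(x + y)\<^sup>2 \<le> 2 * x\<^sup>2 + 2 * y\<^sup>2" for x y :: real
    using zero_le_power2[of "x - y"] by (simp add: power2_eq_square algebra_simps)
  have S1: "S\<^sup>2 \<le> 1" and C1: "C\<^sup>2 \<le> 1" using SC by (smt (verit) zero_le_power2)+
  have SC1: "(S * C)\<^sup>2 \<le> 1" unfolding power_mult_distrib using S1 C1 by (simp add: mult_le_one)
  have S4: "(S\<^sup>2)\<^sup>2 \<le> 1" using power_mono[OF S1, of 2] by simp
  have "(N * b * (S * C) + q)\<^sup>2 \<le> 2 * ((N * b)\<^sup>2 * (S * C)\<^sup>2) + 2 * q\<^sup>2"
    using two[of "N * b * (S * C)" q] by (simp only: power_mult_distrib)
  also have "(N * b)\<^sup>2 * (S * C)\<^sup>2 \<le> (N * b)\<^sup>2" using SC1 mult_left_le by fastforce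
  finally have 1: "(N * b * (S * C) + q)\<^sup>2 \<le> 2 * (Kb / w) + 2 * (1 / w)" using b q by linarith
  define m where "m = T / 2 * (S * C) - b1 / (4 * k) * S\<^sup>2"
  have "m\<^sup>2 \<le> 2 * ((T / 2)\<^sup>2 * (S * C)\<^sup>2) + 2 * ((b1 / (4 * k))\<^sup>2 * (S\<^sup>2)\<^sup>2)"
    using two[of "T / 2 * (S * C)" "- (b1 / (4 * k) * S\<^sup>2)"] unfolding m_def
    by (simp only: power_mult_distrib power2_minus diff_conv_add_uminus)
  also have "(T / 2)\<^sup>2 * (S * C)\<^sup>2 \<le> (T / 2)\<^sup>2" using SC1 mult_left_le by fastforce
  also have "(b1 / (4 * k))\<^sup>2 * (S\<^sup>2)\<^sup>2 \<le> (b1 / (4 * k))\<^sup>2" using S4 mult_left_le by fastforce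
  also have "2 * (T / 2)\<^sup>2 + 2 * (b1 / (4 * k))\<^sup>2 \<le> T\<^sup>2 + b1\<^sup>2 / k\<^sup>2"
    using k by (simp add: power_divide power_mult_distrib field_simps)
  also have "b1\<^sup>2 / k\<^sup>2 \<le> Kb1 / k\<^sup>2 / w" using divide_right_mono[OF b1, of "k\<^sup>2"] by (simp add: mult.commute)
  finally have 2: "m\<^sup>2 \<le> KT / w + Kb1 / k\<^sup>2 / w" using T by linarith
  have "\<epsilon>\<^sup>2 * ((N * b * (S * C) + q)\<^sup>2 + m\<^sup>2) \<le> \<epsilon>\<^sup>2 * ((2 * Kb + 2 + KT + Kb1 / k\<^sup>2) / w)"
    by (intro mult_left_mono) (use 1 2 in \<open>simp_all add: add_divide_distrib\<close>)
  also have "\<dots> = \<epsilon> * (\<epsilon> * (2 * Kb + 2 + KT + Kb1 / k\<^sup>2)) / w" by (simp add: power2_eq_square)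
  also have "\<dots> \<le> \<epsilon> * (\<kappa> / 2) / w" by (intro divide_right_mono mult_left_mono \<epsilon>) (use \<epsilon> w in auto)
  finally have quad: "(\<epsilon> * (N * b * (S * C) + q))\<^sup>2 + \<epsilon>\<^sup>2 * m\<^sup>2 \<le> \<epsilon> * (\<kappa> / 2) / w"
    by (subst power_mult_distrib) (simp only: distrib_left[of "\<epsilon>\<^sup>2"])
  have "\<epsilon> * (\<kappa> / w) \<le> \<epsilon> * (P + k * T / 2)" using lin \<epsilon> by (intro mult_left_mono) auto
  then have "\<epsilon> * (\<kappa> / 2) / w + \<epsilon> * (\<kappa> / 2) / w \<le> \<epsilon> * (P + k * T / 2)"
    by (simp add: field_simps)
  with quad riccati_identity[OF SC, of k \<epsilon> b1 P T "\<epsilon> * (N * b * (S * C) + q)"] k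
  show ?thesis unfolding m_def by linarith
qed

text \<open>For \<open>f2\<close> only the angular derivative is asked for, as a divergence requires
  no other. It may therefore contain \<theta>' and \<open>bump'\<close>, which are merely continuous
  in r. The cotangent is the reason for excluding the zeros of the sine.\<close>

lemma calibrating_field:
  fixes \<theta>' :: "real \<Rightarrow> real"
  assumes cont: "continuous_on {0..} \<theta>'" and nz: "\<exists>r\<ge>0. \<theta>' r \<noteq> 0" and k: "0 < k"
  obtains c f1 f1r f1p f2 f2p where "0 < c"
    "\<And>r p. 0 < r \<Longrightarrow> ((\<lambda>r. f1 r p) has_real_derivative f1r r p) (at r)"
    "\<And>r p. 0 < r \<Longrightarrow> (f1 r has_real_derivative f1p r p) (at p)"
    "\<And>r p. 0 < r \<Longrightarrow> sin (k * p) \<noteq> 0 \<Longrightarrow> (f2 r has_real_derivative f2p r p) (at p)"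
    "continuous_on ({0<..} \<times> UNIV) (\<lambda>(r, p). f1 r p)"
    "continuous_on ({0<..} \<times> UNIV) (\<lambda>(r, p). f1r r p)"
    "continuous_on ({0<..} \<times> UNIV) (\<lambda>(r, p). f1p r p)"
    "continuous_on ({0<..} \<times> {p. sin (k * p) \<noteq> 0}) (\<lambda>(r, p). f2 r p)"
    "continuous_on ({0<..} \<times> {p. sin (k * p) \<noteq> 0}) (\<lambda>(r, p). f2p r p)"
    "\<And>r p. 0 < r \<Longrightarrow> sin (k * p) \<noteq> 0 \<Longrightarrow>
       k\<^sup>2 + c * (r\<^sup>2 / (1 + r\<^sup>2 * (ln r)\<^sup>2))
       \<le> r * f1r r p - r * \<theta>' r * f1p r p + f2p r p - (f1 r p)\<^sup>2 - (f2 r p)\<^sup>2"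
proof -
  obtain t0 \<delta> d M \<sigma> where \<delta>: "0 < \<delta>" and d: "0 < d" and \<sigma>: "\<bar>\<sigma>\<bar> = 1"
    and anchor: "\<And>r. 0 < r \<Longrightarrow> \<bar>(ln r - t0) / \<delta>\<bar> < 3 \<Longrightarrow> d \<le> \<sigma> * (r * \<theta>' r) \<and> \<bar>r * \<theta>' r\<bar> \<le> M"
    using twist_anchor[OF cont nz] by blast
  define L where "L r = (ln r - t0) / \<delta>" for r
  define w where "w r = 1 + (L r)\<^sup>2" for r
  have w: "1 \<le> w r" for r by (simp add: w_def)
  \<comment> \<open>The sign \<open>\<sigma>\<close> makes \<open>T\<close> nonnegative for either
    direction of the twist. The size gives T \<ge> 4/(\<delta> k) on \<bar>s\<bar> \<le> 2, hence k
    T / 2 \<ge> 2/\<delta>: one 1/\<delta> cancels the worst value of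
    \<open>slope' / \<delta>\<close>, the other remains as gain.\<close>
  define N where "N = \<sigma> * (4 / (\<delta> * k * d))"
  define T where "T r = r * \<theta>' r * (N * bump (L r))" for r
  define \<kappa> where "\<kappa> = 3 / 5 / \<delta>"
  define Kb where "Kb = N\<^sup>2 * 10^6"
  define KT where "KT = M\<^sup>2 * Kb"
  define Kb1 where "Kb1 = (N / \<delta>)\<^sup>2 * 10^6"
  define K where "K = 2 * Kb + 2 + KT + Kb1 / k\<^sup>2"
  have "0 \<le> Kb" "0 \<le> KT" "0 \<le> Kb1" by (simp_all add: Kb_def KT_def Kb1_def)
  then have K: "0 < K" by (simp add: K_def add_nonneg_pos add_pos_nonneg)
  have \<kappa>: "0 < \<kappa>" using \<delta> by (simp add: \<kappa>_def)
  define \<epsilon> where "\<epsilon> = \<kappa> / 2 / K"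
  have \<epsilon>: "0 < \<epsilon>" "\<epsilon> * K \<le> \<kappa> / 2" using K \<kappa> by (simp_all add: \<epsilon>_def)
  define c0 where "c0 = 9 * (1 + 2 * t0\<^sup>2 / \<delta>\<^sup>2) + 2 / \<delta>\<^sup>2"
  have c0: "0 < c0" using \<delta> by (simp add: c0_def add_pos_nonneg)
  \<comment> \<open>Half of the first-order gain survives the quadratic losses; \<open>c0\<close> is
    the price of passing from 1/(1 + s^2) to the logarithmic weight.\<close>
  define c where "c = \<epsilon> * (\<kappa> / 2) / c0"
  define f1 where "f1 r p = \<epsilon> * (N * bump (L r) * (sin (k * p) * cos (k * p)) + slope (L r))" for r p
  define f1r where "f1r r p = \<epsilon> * (N / \<delta> * bump' (L r) * (sin (k * p) * cos (k * p)) + slope' (L r) / \<delta>) / r" for r p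
  define f1p where "f1p r p = \<epsilon> * (N * bump (L r)) * k * ((cos (k * p))\<^sup>2 - (sin (k * p))\<^sup>2)" for r p
  define f2 where "f2 r p = - k * (cos (k * p) / sin (k * p)) +
     \<epsilon> * (T r / 2 * (sin (k * p) * cos (k * p)) - (N / \<delta> * bump' (L r)) / (4 * k) * (sin (k * p))\<^sup>2)" for r p
  define f2p where "f2p r p = k\<^sup>2 / (sin (k * p))\<^sup>2 + \<epsilon> * (T r / 2 * k * ((cos (k * p))\<^sup>2 - (sin (k * p))\<^sup>2)
      - (N / \<delta> * bump' (L r)) / 2 * (sin (k * p) * cos (k * p)))" for r p
  have L': "(L has_real_derivative 1 / (\<delta> * r)) (at r)" if "0 < r" for r
    unfolding L_def using that \<delta> by (auto intro!: derivative_eq_intros simp: field_simps)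
  have cL: "continuous_on ({0<..} \<times> X) (\<lambda>z. L (fst z))" for X :: "real set"
    unfolding L_def using \<delta> by (intro continuous_intros) auto
  have cb: "continuous_on UNIV bump" "continuous_on UNIV bump'" "continuous_on UNIV slope" "continuous_on UNIV slope'"
  proof -
    have nz: "1 + s\<^sup>2 \<noteq> 0" for s :: real by (smt (verit) zero_le_power2)
    show "continuous_on UNIV bump" "continuous_on UNIV bump'" "continuous_on UNIV slope" "continuous_on UNIV slope'"
      unfolding bump_def[abs_def] bump'_def[abs_def] slope_def[abs_def] slope'_def[abs_def]
      by (intro continuous_intros; simp add: nz)+
  qed
  note cbL = cb[THEN continuous_on_compose2, OF cL subset_UNIV]
  have c\<theta>: "continuous_on ({0<..} \<times> X) (\<lambda>z. \<theta>' (fst z))" for X :: "real set"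
    by (intro continuous_on_compose2[OF cont] continuous_intros) auto
  show ?thesis
  proof (rule that[of c f1 f1r f1p f2 f2p])
    show "0 < c" using \<epsilon> \<kappa> c0 by (simp add: c_def)
    fix r p :: real assume r: "0 < r"
    show "((\<lambda>r. f1 r p) has_real_derivative f1r r p) (at r)"
      unfolding f1_def f1r_def using r \<delta>
      by (auto intro!: derivative_eq_intros DERIV_chain2[OF bump_deriv] DERIV_chain2[OF slope_deriv] L' simp: field_simps)
    show "(f1 r has_real_derivative f1p r p) (at p)"
      unfolding f1_def[abs_def] f1p_def
      by (auto intro!: derivative_eq_intros simp: field_simps power2_eq_square)
    assume s: "sin (k * p) \<noteq> 0"
    have sc1: "(cos (k * p))\<^sup>2 = 1 - (sin (k * p))\<^sup>2" by (simp add: cos_squared_eq)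
    show "(f2 r has_real_derivative f2p r p) (at p)"
    proof -
      have "((\<lambda>p. cos (k * p) / sin (k * p)) has_real_derivative - k / (sin (k * p))\<^sup>2) (at p)"
      proof -
        have "((\<lambda>p. cos (k * p) / sin (k * p)) has_real_derivative
           (- sin (k * p) * k * sin (k * p) - cos (k * p) * (cos (k * p) * k)) / (sin (k * p) * sin (k * p))) (at p)"
          using s by (auto intro!: derivative_eq_intros)
        moreover have "- sin (k * p) * k * sin (k * p) - cos (k * p) * (cos (k * p) * k) = - k * ((sin (k * p))\<^sup>2 + (cos (k * p))\<^sup>2)"
          by algebra
        moreover have "\<dots> = - k" by simp
        ultimately show ?thesis by (simp only: power2_eq_square)
      qed
      from DERIV_cmult[OF this, of "- k"]
      have 1: "((\<lambda>p. - k * (cos (k * p) / sin (k * p))) has_real_derivative k\<^sup>2 / (sin (k * p))\<^sup>2) (at p)"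
        by (simp add: power2_eq_square)
      have 2: "((\<lambda>p. A * (sin (k * p) * cos (k * p)) - B / (4 * k) * (sin (k * p))\<^sup>2) has_real_derivative
          A * k * ((cos (k * p))\<^sup>2 - (sin (k * p))\<^sup>2) - B / 2 * (sin (k * p) * cos (k * p))) (at p)" for A B
        using k by (auto intro!: derivative_eq_intros simp: field_simps power2_eq_square)
      show ?thesis unfolding f2_def[abs_def] f2p_def
        by (rule DERIV_add[OF 1 DERIV_cmult[OF 2]])
    qed
    define S where "S = sin (k * p)"
    define C where "C = cos (k * p)"
    have b: "(N * bump (L r))\<^sup>2 \<le> Kb / w r"
      using mult_left_mono[OF bump_bounds(1)[of "L r"], of "N\<^sup>2"]
      by (simp add: Kb_def w_def power_mult_distrib)
    have b1: "(N / \<delta> * bump' (L r))\<^sup>2 \<le> Kb1 / w r"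
      using mult_left_mono[OF bump_bounds(2)[of "L r"], of "(N / \<delta>)\<^sup>2"]
      by (simp add: Kb1_def w_def power_mult_distrib power_divide)
    have T: "(T r)\<^sup>2 \<le> KT / w r"
    proof (cases "\<bar>L r\<bar> < 3")
      case False then show ?thesis using w[of r] \<open>0 \<le> KT\<close> by (simp add: T_def bump_zero)
    next
      case True
      then have "(r * \<theta>' r)\<^sup>2 \<le> M\<^sup>2"
        using anchor[OF r] by (intro abs_le_square_iff[THEN iffD1]) (auto simp: L_def)
      then have "(r * \<theta>' r)\<^sup>2 * (N * bump (L r))\<^sup>2 \<le> M\<^sup>2 * (Kb / w r)"
        using b by (rule mult_mono) auto
      then show ?thesis by (simp add: T_def KT_def power_mult_distrib)
    qed
    \<comment> \<open>The split is at \<bar>s\<bar> = 2. Inside, the twist outweighs the negative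
      slope; outside, the slope suffices by itself and the twist term is nonnegative.\<close>
    have lin: "\<kappa> / w r \<le> slope' (L r) / \<delta> + k * T r / 2"
    proof -
      have T0: "0 \<le> T r \<and> (\<bar>L r\<bar> \<le> 2 \<longrightarrow> 4 / (\<delta> * k) \<le> T r)"
      proof (cases "\<bar>L r\<bar> < 3")
        case False then show ?thesis by (simp add: T_def bump_zero)
      next
        case True
        then have "d \<le> \<sigma> * (r * \<theta>' r)" using anchor[OF r] by (simp add: L_def)
        then have "4 / (\<delta> * k * d) * d \<le> 4 / (\<delta> * k * d) * (\<sigma> * (r * \<theta>' r))"
          using \<delta> k d by (intro mult_left_mono) auto
        then have *: "4 / (\<delta> * k) \<le> r * \<theta>' r * N" using d by (simp add: N_def mult_ac)
        moreover have "0 < 4 / (\<delta> * k)" using \<delta> k by simp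
        ultimately have pos: "0 \<le> r * \<theta>' r * N" by linarith
        have "T r = r * \<theta>' r * N * bump (L r)" by (simp add: T_def)
        moreover have "r * \<theta>' r * N * 1 \<le> r * \<theta>' r * N * bump (L r)" if "\<bar>L r\<bar> \<le> 2"
          using pos bump_ge[OF that] by (intro mult_left_mono)
        ultimately show ?thesis using * pos bump_nonneg[of "L r"] by auto
      qed
      show ?thesis
      proof (cases "\<bar>L r\<bar> \<le> 2")
        case True
        have "- 1 / (1 + (L r)\<^sup>2) / \<delta> \<le> slope' (L r) / \<delta>"
          using slope'_bounds(1) \<delta> by (intro divide_right_mono) auto
        then have 1: "- (1 / \<delta> / w r) \<le> slope' (L r) / \<delta>" by (simp add: w_def mult.commute)
        have "k * (4 / (\<delta> * k)) / 2 \<le> k * T r / 2" using T0 True k by (intro divide_right_mono mult_left_mono) auto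
        then have 2: "2 * (1 / \<delta>) \<le> k * T r / 2" using k by simp
        have 3: "1 / \<delta> / w r \<le> 1 / \<delta>" using w[of r] \<delta> by (simp add: divide_simps)
        have "\<kappa> / w r \<le> 1 / \<delta> / w r" using w[of r] \<delta> by (intro divide_right_mono) (auto simp: \<kappa>_def divide_simps)
        with 1 2 3 show ?thesis by linarith
      next
        case False
        then have "3 / 5 / (1 + (L r)\<^sup>2) / \<delta> \<le> slope' (L r) / \<delta>"
          using slope'_bounds(2)[of "L r"] \<delta> by (intro divide_right_mono) auto
        then have "\<kappa> / w r \<le> slope' (L r) / \<delta>" by (simp add: \<kappa>_def w_def mult_ac)
        moreover have "0 \<le> k * T r / 2" using T0 k by simp
        ultimately show ?thesis by linarith
      qed
    qed
    have w0: "0 < w r" using w[of r] by linarith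
    have SC: "S\<^sup>2 + C\<^sup>2 = 1" "S \<noteq> 0" using s by (auto simp: S_def C_def)
    have "k\<^sup>2 + \<epsilon> * (\<kappa> / 2) / w r \<le> \<epsilon> * (N / \<delta> * bump' (L r) * (S * C) + slope' (L r) / \<delta>) - \<epsilon> * T r * k * (C\<^sup>2 - S\<^sup>2)
       + (k\<^sup>2 / S\<^sup>2 + \<epsilon> * (T r / 2 * k * (C\<^sup>2 - S\<^sup>2) - N / \<delta> * bump' (L r) / 2 * (S * C)))
       - (\<epsilon> * (N * bump (L r) * (S * C) + slope (L r)))\<^sup>2
       - (- k * (C / S) + \<epsilon> * (T r / 2 * (S * C) - N / \<delta> * bump' (L r) / (4 * k) * S\<^sup>2))\<^sup>2"
      using \<epsilon> by (intro calibration_lower_bound[OF w0 SC k lin b _ T b1]) (auto simp: K_def w_def slope_bound)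
    \<comment> \<open>Since s is affine in ln r, the operator r d/dr acts as (1/\<delta>) d/ds; this
      is why \<open>bump'\<close> and \<open>slope'\<close> appear divided by
      \<open>\<delta>\<close> and without a power of r.\<close>
    also have "\<dots> = r * f1r r p - r * \<theta>' r * f1p r p + f2p r p - (f1 r p)\<^sup>2 - (f2 r p)\<^sup>2"
      unfolding f1_def f1r_def f1p_def f2_def f2p_def S_def C_def
      using r by (simp add: T_def mult_ac)
    finally have main: "k\<^sup>2 + \<epsilon> * (\<kappa> / 2) / w r \<le> r * f1r r p - r * \<theta>' r * f1p r p + f2p r p - (f1 r p)\<^sup>2 - (f2 r p)\<^sup>2" .
    have "c * (r\<^sup>2 / (1 + r\<^sup>2 * (ln r)\<^sup>2)) \<le> c * (c0 / w r)"
      using log_weight_bound[OF r \<delta>, of t0] \<open>0 < c\<close> by (intro mult_left_mono) (auto simp: c0_def w_def L_def)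
    also have "\<dots> = \<epsilon> * (\<kappa> / 2) / w r" using c0 by (simp add: c_def)
    finally show "k\<^sup>2 + c * (r\<^sup>2 / (1 + r\<^sup>2 * (ln r)\<^sup>2))
       \<le> r * f1r r p - r * \<theta>' r * f1p r p + f2p r p - (f1 r p)\<^sup>2 - (f2 r p)\<^sup>2" using main by linarith
  next
    show "continuous_on ({0<..} \<times> UNIV) (\<lambda>(r, p). f1 r p)"
      unfolding f1_def case_prod_unfold by (intro continuous_intros cbL)
    show "continuous_on ({0<..} \<times> UNIV) (\<lambda>(r, p). f1r r p)"
      unfolding f1r_def case_prod_unfold using \<delta> by (intro continuous_intros cbL) auto
    show "continuous_on ({0<..} \<times> UNIV) (\<lambda>(r, p). f1p r p)"
      unfolding f1p_def case_prod_unfold by (intro continuous_intros cbL)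
    show "continuous_on ({0<..} \<times> {p. sin (k * p) \<noteq> 0}) (\<lambda>(r, p). f2 r p)"
      unfolding f2_def T_def case_prod_unfold using k by (intro continuous_intros cbL c\<theta>) auto
    show "continuous_on ({0<..} \<times> {p. sin (k * p) \<noteq> 0}) (\<lambda>(r, p). f2p r p)"
      unfolding f2p_def T_def case_prod_unfold using k by (intro continuous_intros cbL c\<theta>) auto
  qed
qed

subsection \<open>The inequality on a rectangle\<close>

text \<open>Each summand is integrated first in its own variable, by the fundamental theorem of
  calculus, and then in the other. So \<open>A\<close> needs a derivative in r only and
  \<open>B\<close> in the angle only, which matches the limited regularity of the field.\<close>

lemma rectangle_divergence:
  fixes A B A' B' :: "real \<Rightarrow> real \<Rightarrow> real"
  assumes le: "r1 \<le> r2" "p1 \<le> p2"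
    and dA: "\<And>r p. r1 \<le> r \<Longrightarrow> r \<le> r2 \<Longrightarrow> p1 \<le> p \<Longrightarrow> p \<le> p2 \<Longrightarrow> ((\<lambda>r. A r p) has_real_derivative A' r p) (at r)"
    and dB: "\<And>r p. r1 \<le> r \<Longrightarrow> r \<le> r2 \<Longrightarrow> p1 \<le> p \<Longrightarrow> p \<le> p2 \<Longrightarrow> (B r has_real_derivative B' r p) (at p)"
    and cA: "continuous_on (cbox (r1, p1) (r2, p2)) (\<lambda>(r, p). A' r p)"
    and cB: "continuous_on (cbox (r1, p1) (r2, p2)) (\<lambda>(r, p). B' r p)"
    and zA: "\<And>p. p1 \<le> p \<Longrightarrow> p \<le> p2 \<Longrightarrow> A r1 p = 0 \<and> A r2 p = 0"
    and zB: "\<And>r. r1 \<le> r \<Longrightarrow> r \<le> r2 \<Longrightarrow> B r p1 = 0 \<and> B r p2 = 0"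
  shows "integral (cbox (r1, p1) (r2, p2)) (\<lambda>(r, p). A' r p + B' r p) = 0"
proof -
  have "integral (cbox r1 r2) (\<lambda>r. A' r p) = 0" if "p \<in> cbox p1 p2" for p
  proof -
    have "((\<lambda>r. A' r p) has_integral A r2 p - A r1 p) {r1..r2}"
    proof (rule fundamental_theorem_of_calculus[where f = "\<lambda>r. A r p", OF le(1)])
      fix x assume "x \<in> {r1..r2}"
      then show "((\<lambda>r. A r p) has_vector_derivative A' x p) (at x within {r1..r2})"
        by (intro has_vector_derivative_at_within[OF has_real_derivative_iff_has_vector_derivative[THEN iffD1, OF dA]])
          (use that in auto)
    qed
    from integral_unique[OF this] show ?thesis using zA[of p] that by simp
  qed
  then have "integral (cbox p1 p2) (\<lambda>p. integral (cbox r1 r2) (\<lambda>r. A' r p)) = integral (cbox p1 p2) (\<lambda>p. 0)"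
    by (intro integral_cong) auto
  then have IA: "integral (cbox (r1, p1) (r2, p2)) (\<lambda>(r, p). A' r p) = 0"
    unfolding integral_prod_continuous[OF cA] by (simp only: prod.case integral_swap_continuous[OF cA] integral_0)
  have "integral (cbox p1 p2) (B' r) = 0" if "r \<in> cbox r1 r2" for r
  proof -
    have "(B' r has_integral B r p2 - B r p1) {p1..p2}"
    proof (rule fundamental_theorem_of_calculus[where f = "B r", OF le(2)])
      fix x assume "x \<in> {p1..p2}"
      then show "((B r) has_vector_derivative B' r x) (at x within {p1..p2})"
        by (intro has_vector_derivative_at_within[OF has_real_derivative_iff_has_vector_derivative[THEN iffD1, OF dB]])
          (use that in auto)
    qed
    from integral_unique[OF this] show ?thesis using zB[of r] that by simp
  qed
  then have "integral (cbox r1 r2) (\<lambda>r. integral (cbox p1 p2) (B' r)) = integral (cbox r1 r2) (\<lambda>r. 0)"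
    by (intro integral_cong) auto
  then have IB: "integral (cbox (r1, p1) (r2, p2)) (\<lambda>(r, p). B' r p) = 0"
    using integral_prod_continuous[OF cB] by simp
  have "integral (cbox (r1, p1) (r2, p2)) (\<lambda>z. (\<lambda>(r, p). A' r p) z + (\<lambda>(r, p). B' r p) z) = 0"
    using IA IB by (subst integral_add) (auto intro: integrable_continuous cA cB)
  then show ?thesis by (simp add: case_prod_unfold)
qed

text \<open>The squares of vr - \<theta>' vp + f1 v / r and (vp + f2 v)/r are nonnegative. Their
  cross terms, together with the derivatives of the field, form the divergence of v^2 (f1, f2 / r -
  \<theta>' f1), which is the last bracket; the remaining coefficient of v^2 is bounded below by
  \<open>ric\<close>. The component -\<theta>' f1 arises because the radial derivative acts along
  d/dr - \<theta>' d/d\<phi>.\<close>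

lemma completed_square_bound:
  fixes v vr vp f1 f1r f1p f2 f2p \<theta>' r :: real
  assumes r: "0 < r"
    and ric: "k\<^sup>2 + c * (r\<^sup>2 / W) \<le> r * f1r - r * \<theta>' * f1p + f2p - f1\<^sup>2 - f2\<^sup>2"
  shows "r * ((k\<^sup>2 / r\<^sup>2 + c / W) * v\<^sup>2) \<le> r * ((vr - \<theta>' * vp)\<^sup>2 + (vp / r)\<^sup>2)
     + ((2 * v * vr * f1 + v\<^sup>2 * f1r) + (2 * v * vp * (f2 / r - \<theta>' * f1) + v\<^sup>2 * (f2p / r - \<theta>' * f1p)))"
proof -
  have "0 \<le> r * ((vr - \<theta>' * vp + f1 / r * v)\<^sup>2 + (vp / r + f2 / r * v)\<^sup>2)"
    using r by simp
  also have "\<dots> = r * ((vr - \<theta>' * vp)\<^sup>2 + (vp / r)\<^sup>2) + 2 * v * (vr - \<theta>' * vp) * f1 + 2 * v * vp * f2 / r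
      + v\<^sup>2 / r * (f1\<^sup>2 + f2\<^sup>2)"
    using r by (simp add: power2_eq_square field_simps)
  finally have 1: "0 \<le> \<dots>" .
  have "v\<^sup>2 / r * (k\<^sup>2 + c * (r\<^sup>2 / W)) \<le> v\<^sup>2 / r * (r * f1r - r * \<theta>' * f1p + f2p - f1\<^sup>2 - f2\<^sup>2)"
    using r by (intro mult_left_mono ric) auto
  also have "v\<^sup>2 / r * (k\<^sup>2 + c * (r\<^sup>2 / W)) = r * ((k\<^sup>2 / r\<^sup>2 + c / W) * v\<^sup>2)"
    using r by (simp add: power2_eq_square field_simps)
  also have "v\<^sup>2 / r * (r * f1r - r * \<theta>' * f1p + f2p - f1\<^sup>2 - f2\<^sup>2)
     = v\<^sup>2 * (f1r - \<theta>' * f1p + f2p / r) - v\<^sup>2 / r * (f1\<^sup>2 + f2\<^sup>2)"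
    using r by (simp add: field_simps)
  finally have 2: "r * ((k\<^sup>2 / r\<^sup>2 + c / W) * v\<^sup>2) \<le> \<dots>" .
  have 3: "(2 * v * vr * f1 + v\<^sup>2 * f1r) + (2 * v * vp * (f2 / r - \<theta>' * f1) + v\<^sup>2 * (f2p / r - \<theta>' * f1p))
    = 2 * v * (vr - \<theta>' * vp) * f1 + 2 * v * vp * f2 / r + v\<^sup>2 * (f1r - \<theta>' * f1p + f2p / r)"
    by (simp add: algebra_simps)
  show ?thesis using 1 2 unfolding 3 by linarith
qed

lemma rectangle_hardy:
  fixes v vr vp f1 f1r f1p f2 f2p :: "real \<Rightarrow> real \<Rightarrow> real" and W \<theta>' :: "real \<Rightarrow> real"
  defines "Q \<equiv> \<lambda>r1 p1 r2 p2. cbox (r1, p1) (r2, p2)"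
  assumes le: "0 < r1" "r1 \<le> r2" "p1 \<le> p2"
    and dv: "\<And>r p. r1 \<le> r \<Longrightarrow> r \<le> r2 \<Longrightarrow> p1 \<le> p \<Longrightarrow> p \<le> p2 \<Longrightarrow> ((\<lambda>r. v r p) has_real_derivative vr r p) (at r)"
      "\<And>r p. r1 \<le> r \<Longrightarrow> r \<le> r2 \<Longrightarrow> p1 \<le> p \<Longrightarrow> p \<le> p2 \<Longrightarrow> (v r has_real_derivative vp r p) (at p)"
    and df: "\<And>r p. r1 \<le> r \<Longrightarrow> r \<le> r2 \<Longrightarrow> p1 \<le> p \<Longrightarrow> p \<le> p2 \<Longrightarrow> ((\<lambda>r. f1 r p) has_real_derivative f1r r p) (at r)"
      "\<And>r p. r1 \<le> r \<Longrightarrow> r \<le> r2 \<Longrightarrow> p1 \<le> p \<Longrightarrow> p \<le> p2 \<Longrightarrow> (f1 r has_real_derivative f1p r p) (at p)"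
      "\<And>r p. r1 \<le> r \<Longrightarrow> r \<le> r2 \<Longrightarrow> p1 \<le> p \<Longrightarrow> p \<le> p2 \<Longrightarrow> (f2 r has_real_derivative f2p r p) (at p)"
    and cv: "continuous_on (Q r1 p1 r2 p2) (\<lambda>(r, p). v r p)" "continuous_on (Q r1 p1 r2 p2) (\<lambda>(r, p). vr r p)"
      "continuous_on (Q r1 p1 r2 p2) (\<lambda>(r, p). vp r p)"
    and cf: "continuous_on (Q r1 p1 r2 p2) (\<lambda>(r, p). f1 r p)" "continuous_on (Q r1 p1 r2 p2) (\<lambda>(r, p). f1r r p)"
      "continuous_on (Q r1 p1 r2 p2) (\<lambda>(r, p). f1p r p)"
      "continuous_on (Q r1 p1 r2 p2) (\<lambda>(r, p). f2 r p)" "continuous_on (Q r1 p1 r2 p2) (\<lambda>(r, p). f2p r p)"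
    and c\<theta>: "continuous_on {r1..r2} \<theta>'"
    and W: "continuous_on {r1..r2} W" "\<And>r. r1 \<le> r \<Longrightarrow> r \<le> r2 \<Longrightarrow> W r \<noteq> 0"
    and zv: "\<And>p. p1 \<le> p \<Longrightarrow> p \<le> p2 \<Longrightarrow> v r1 p = 0 \<and> v r2 p = 0"
      "\<And>r. r1 \<le> r \<Longrightarrow> r \<le> r2 \<Longrightarrow> v r p1 = 0 \<and> v r p2 = 0"
    and ric: "\<And>r p. r1 \<le> r \<Longrightarrow> r \<le> r2 \<Longrightarrow> p1 \<le> p \<Longrightarrow> p \<le> p2 \<Longrightarrow>
       k\<^sup>2 + c * (r\<^sup>2 / W r) \<le> r * f1r r p - r * \<theta>' r * f1p r p + f2p r p - (f1 r p)\<^sup>2 - (f2 r p)\<^sup>2"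
  shows "integral (Q r1 p1 r2 p2) (\<lambda>(r, p). r * ((k\<^sup>2 / r\<^sup>2 + c / W r) * (v r p)\<^sup>2))
    \<le> integral (Q r1 p1 r2 p2) (\<lambda>(r, p). r * ((vr r p - \<theta>' r * vp r p)\<^sup>2 + (vp r p / r)\<^sup>2))"
proof -
  let ?Q = "cbox (r1, p1) (r2, p2)"
  have mem: "z \<in> ?Q \<longleftrightarrow> r1 \<le> fst z \<and> fst z \<le> r2 \<and> p1 \<le> snd z \<and> snd z \<le> p2" for z
    by (cases z) (auto simp: cbox_Pair_eq)
  have r0: "fst z \<noteq> 0" if "z \<in> ?Q" for z using that le by (auto simp: mem)
  note c[continuous_intros] = cv[unfolded Q_def case_prod_unfold] cf[unfolded Q_def case_prod_unfold]
  have [continuous_intros]: "continuous_on ?Q (\<lambda>z. \<theta>' (fst z))" "continuous_on ?Q (\<lambda>z. W (fst z))"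
    by (auto intro!: continuous_on_compose2[OF c\<theta>] continuous_on_compose2[OF W(1)] continuous_intros simp: mem)
  \<comment> \<open>\<open>A\<close> and \<open>B\<close> are the fluxes of the divergence in the
    pointwise bound. The factor v^2 makes them vanish on all four sides, so there is no boundary
    term.\<close>
  define A where "A r p = (v r p)\<^sup>2 * f1 r p" for r p
  define A' where "A' r p = 2 * v r p * vr r p * f1 r p + (v r p)\<^sup>2 * f1r r p" for r p
  define B where "B r p = (v r p)\<^sup>2 * (f2 r p / r - \<theta>' r * f1 r p)" for r p
  define B' where "B' r p = 2 * v r p * vp r p * (f2 r p / r - \<theta>' r * f1 r p) + (v r p)\<^sup>2 * (f2p r p / r - \<theta>' r * f1p r p)" for r p
  have cA: "continuous_on ?Q (\<lambda>(r, p). A' r p)"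
    unfolding A'_def case_prod_unfold by (intro continuous_intros)
  have cB: "continuous_on ?Q (\<lambda>(r, p). B' r p)"
    unfolding B'_def case_prod_unfold by (intro continuous_intros ballI r0)
  have I0: "integral ?Q (\<lambda>(r, p). A' r p + B' r p) = 0"
  proof (rule rectangle_divergence[where A = A and B = B, OF le(2,3) _ _ cA cB])
    fix r p assume rp: "r1 \<le> r" "r \<le> r2" "p1 \<le> p" "p \<le> p2"
    show "((\<lambda>r. A r p) has_real_derivative A' r p) (at r)"
      unfolding A_def A'_def
      by (auto intro!: derivative_eq_intros dv(1)[OF rp] df(1)[OF rp])
    show "(B r has_real_derivative B' r p) (at p)"
      unfolding B_def[abs_def] B'_def using rp le
      by (auto intro!: derivative_eq_intros dv(2)[OF rp] df(2,3)[OF rp])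
  qed (auto simp: A_def B_def zv)
  let ?E = "\<lambda>(r, p). r * ((vr r p - \<theta>' r * vp r p)\<^sup>2 + (vp r p / r)\<^sup>2)"
  have cE: "continuous_on ?Q ?E"
    unfolding case_prod_unfold by (intro continuous_intros ballI r0)
  have cL: "continuous_on ?Q (\<lambda>(r, p). r * ((k\<^sup>2 / r\<^sup>2 + c / W r) * (v r p)\<^sup>2))"
    unfolding case_prod_unfold by (intro continuous_intros) (use r0 W mem in auto)
  have iAB: "(\<lambda>(r, p). A' r p + B' r p) integrable_on ?Q"
    using integrable_add[OF integrable_continuous[OF cA] integrable_continuous[OF cB]] by (simp add: case_prod_unfold)
  have "integral ?Q (\<lambda>(r, p). r * ((k\<^sup>2 / r\<^sup>2 + c / W r) * (v r p)\<^sup>2))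
     \<le> integral ?Q (\<lambda>z. ?E z + (\<lambda>(r, p). A' r p + B' r p) z)"
  proof (rule integral_le)
    show "(\<lambda>(r, p). r * ((k\<^sup>2 / r\<^sup>2 + c / W r) * (v r p)\<^sup>2)) integrable_on ?Q"
      by (rule integrable_continuous[OF cL])
    show "(\<lambda>z. ?E z + (\<lambda>(r, p). A' r p + B' r p) z) integrable_on ?Q"
      by (rule integrable_add[OF integrable_continuous[OF cE] iAB])
    fix z assume "z \<in> ?Q"
    then obtain r p where z: "z = (r, p)" and rp: "r1 \<le> r" "r \<le> r2" "p1 \<le> p" "p \<le> p2"
      by (cases z) (auto simp: mem)
    then show "(\<lambda>(r, p). r * ((k\<^sup>2 / r\<^sup>2 + c / W r) * (v r p)\<^sup>2)) z \<le> ?E z + (\<lambda>(r, p). A' r p + B' r p) z"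
      using completed_square_bound[OF _ ric[OF rp], where v = "v r p" and vr = "vr r p" and vp = "vp r p"] le
      by (simp add: A'_def B'_def)
  qed
  also have "\<dots> = integral ?Q ?E + integral ?Q (\<lambda>(r, p). A' r p + B' r p)"
    by (rule integral_add[OF integrable_continuous[OF cE] iAB])
  finally show ?thesis using I0 by (simp add: Q_def)
qed

subsection \<open>Passage from test functions to the Sobolev space\<close>

lemma test_fun_differentiable:
  assumes "test_fun \<Omega> \<phi>"
  shows "\<phi> differentiable (at x)" "b \<in> Basis \<Longrightarrow> pderiv_dir b \<phi> differentiable (at x)"
proof -
  have *: "foldr pderiv_dir vs \<phi> differentiable_on UNIV" if "set vs \<subseteq> Basis" for vs
    using assms that by (auto simp: test_fun_def smooth_on_def)
  show "\<phi> differentiable (at x)" using *[of "[]"] by (simp add: differentiable_on_def)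
  show "pderiv_dir b \<phi> differentiable (at x)" if "b \<in> Basis" using *[of "[b]"] that by (simp add: differentiable_on_def)
qed

lemma continuous_pderiv_dir:
  assumes "test_fun \<Omega> \<phi>" "b \<in> Basis"
  shows "continuous_on S (pderiv_dir b \<phi>)"
  using test_fun_differentiable(2)[OF assms]
  by (intro continuous_at_imp_continuous_on ballI differentiable_imp_continuous_within)

lemma continuous_test_fun:
  assumes "test_fun \<Omega> \<phi>"
  shows "continuous_on S \<phi>"
  using test_fun_differentiable(1)[OF assms]
  by (intro continuous_at_imp_continuous_on ballI differentiable_imp_continuous_within)

lemma continuous_grad:
  assumes "test_fun \<Omega> \<phi>"
  shows "continuous_on S (grad \<phi>)"
proof -
  have "continuous_on S (\<lambda>x. \<Sum>b\<in>Basis. pderiv_dir b \<phi> x *\<^sub>R b)"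
    by (intro continuous_intros continuous_pderiv_dir[OF assms])
  then show ?thesis by (simp add: grad_def[abs_def] pderiv_dir_def)
qed

text \<open>Young's inequality, from the square of s x - y / s with s^2 = \<eta>. The factor of the
  main term tends to 1 with \<eta>, so approximation does not spoil the constant of the Hardy
  bound.\<close>

lemma weighted_square_sum_le:
  fixes x y :: "'a::real_inner"
  assumes "0 < \<eta>"
  shows "(norm (x + y))\<^sup>2 \<le> (1 + \<eta>) * (norm x)\<^sup>2 + (1 + 1 / \<eta>) * (norm y)\<^sup>2"
proof -
  define s where "s = sqrt \<eta>"
  have s: "0 < s" "s\<^sup>2 = \<eta>" using assms by (simp_all add: s_def)
  have "0 \<le> (norm (s *\<^sub>R x - (1 / s) *\<^sub>R y))\<^sup>2" by simp
  also have "\<dots> = \<eta> * (norm x)\<^sup>2 - 2 * (x \<bullet> y) + 1 / \<eta> * (norm y)\<^sup>2"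
    using s by (simp add: power2_norm_eq_inner inner_diff_left inner_diff_right inner_commute power2_eq_square[symmetric] power_divide)
  finally have "2 * (x \<bullet> y) \<le> \<eta> * (norm x)\<^sup>2 + 1 / \<eta> * (norm y)\<^sup>2" by linarith
  moreover have "(norm (x + y))\<^sup>2 = (norm x)\<^sup>2 + 2 * (x \<bullet> y) + (norm y)\<^sup>2"
    by (simp add: power2_norm_eq_inner inner_add_left inner_add_right inner_commute)
  ultimately show ?thesis by (simp add: distrib_right)
qed

text \<open>Truncating the weight makes its quadratic form continuous in \<open>L\<^sup>2\<close>, so no almost everywhere convergent subsequence is needed.\<close>
lemma H01_weighted_bound:
  fixes V :: "'a::euclidean_space \<Rightarrow> real"
  assumes H: "H01 \<Omega> u g" and V [measurable]: "V \<in> borel_measurable borel" and V0: "\<And>x. 0 \<le> V x"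
    and test: "\<And>\<phi>. test_fun \<Omega> \<phi> \<Longrightarrow>
       (\<integral>\<^sup>+ x. ennreal (V x * (\<phi> x)\<^sup>2) \<partial>lborel) \<le> (\<integral>\<^sup>+ x. ennreal ((norm (grad \<phi> x))\<^sup>2) \<partial>lborel)"
  shows "(\<integral>\<^sup>+ x. ennreal (V x * (u x)\<^sup>2) \<partial>lborel) \<le> (\<integral>\<^sup>+ x. ennreal ((norm (g x))\<^sup>2) \<partial>lborel)"
proof -
  from H obtain \<phi> where [measurable]: "u \<in> borel_measurable borel" "g \<in> borel_measurable borel"
    and \<phi>: "\<And>n. test_fun \<Omega> (\<phi> n)"
    and limu: "(\<lambda>n. \<integral>\<^sup>+ x. ennreal ((\<phi> n x - u x)\<^sup>2) \<partial>lborel) \<longlonglongrightarrow> 0"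
    and limg: "(\<lambda>n. \<integral>\<^sup>+ x. ennreal ((norm (grad (\<phi> n) x - g x))\<^sup>2) \<partial>lborel) \<longlonglongrightarrow> 0"
    unfolding H01_def by auto
  have [measurable]: "\<phi> n \<in> borel_measurable borel" "grad (\<phi> n) \<in> borel_measurable borel" for n
    by (auto intro!: borel_measurable_continuous_onI continuous_test_fun[OF \<phi>] continuous_grad[OF \<phi>])
  define G where "G = (\<integral>\<^sup>+ x. ennreal ((norm (g x))\<^sup>2) \<partial>lborel)"
  define a where "a n = (\<integral>\<^sup>+ x. ennreal ((\<phi> n x - u x)\<^sup>2) \<partial>lborel)" for n
  define b where "b n = (\<integral>\<^sup>+ x. ennreal ((norm (grad (\<phi> n) x - g x))\<^sup>2) \<partial>lborel)" for n
  have step: "(\<integral>\<^sup>+ x. ennreal (min (V x) M * (u x)\<^sup>2) \<partial>lborel)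
      \<le> ennreal (1 + \<eta>) * (ennreal (1 + \<eta>) * G + ennreal (1 + 1 / \<eta>) * b n) + ennreal ((1 + 1 / \<eta>) * M) * a n"
    if \<eta>: "0 < \<eta>" and M: "0 \<le> M" for \<eta> M n
  proof -
    have "min (V x) M * (u x)\<^sup>2 \<le> (1 + \<eta>) * (V x * (\<phi> n x)\<^sup>2) + ((1 + 1 / \<eta>) * M) * (\<phi> n x - u x)\<^sup>2" for x
    proof -
      have "(u x)\<^sup>2 \<le> (1 + \<eta>) * (\<phi> n x)\<^sup>2 + (1 + 1 / \<eta>) * (\<phi> n x - u x)\<^sup>2"
        using weighted_square_sum_le[OF \<eta>, of "\<phi> n x" "u x - \<phi> n x"] by (simp add: power2_commute)
      then have "min (V x) M * (u x)\<^sup>2 \<le> min (V x) M * ((1 + \<eta>) * (\<phi> n x)\<^sup>2 + (1 + 1 / \<eta>) * (\<phi> n x - u x)\<^sup>2)"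
        using V0[of x] M by (intro mult_left_mono) auto
      also have "\<dots> = min (V x) M * ((1 + \<eta>) * (\<phi> n x)\<^sup>2) + min (V x) M * ((1 + 1 / \<eta>) * (\<phi> n x - u x)\<^sup>2)"
        by (rule distrib_left)
      also have "\<dots> \<le> V x * ((1 + \<eta>) * (\<phi> n x)\<^sup>2) + M * ((1 + 1 / \<eta>) * (\<phi> n x - u x)\<^sup>2)"
        using \<eta> by (intro add_mono mult_right_mono) auto
      finally show ?thesis by (simp add: mult_ac)
    qed
    then have "(\<integral>\<^sup>+ x. ennreal (min (V x) M * (u x)\<^sup>2) \<partial>lborel)
       \<le> (\<integral>\<^sup>+ x. ennreal ((1 + \<eta>) * (V x * (\<phi> n x)\<^sup>2) + ((1 + 1 / \<eta>) * M) * (\<phi> n x - u x)\<^sup>2) \<partial>lborel)"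
      by (intro nn_integral_mono ennreal_leI)
    also have "\<dots> = (\<integral>\<^sup>+ x. ennreal (1 + \<eta>) * ennreal (V x * (\<phi> n x)\<^sup>2) + ennreal ((1 + 1 / \<eta>) * M) * ennreal ((\<phi> n x - u x)\<^sup>2) \<partial>lborel)"
      using \<eta> M V0 by (intro nn_integral_cong) (simp add: ennreal_mult ennreal_plus)
    also have "\<dots> = ennreal (1 + \<eta>) * (\<integral>\<^sup>+ x. ennreal (V x * (\<phi> n x)\<^sup>2) \<partial>lborel) + ennreal ((1 + 1 / \<eta>) * M) * a n"
      unfolding a_def by (subst nn_integral_add) (auto simp: nn_integral_cmult)
    also have "(\<integral>\<^sup>+ x. ennreal (V x * (\<phi> n x)\<^sup>2) \<partial>lborel) \<le> (\<integral>\<^sup>+ x. ennreal ((norm (grad (\<phi> n) x))\<^sup>2) \<partial>lborel)"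
      by (rule test[OF \<phi>])
    also have "\<dots> \<le> (\<integral>\<^sup>+ x. ennreal (1 + \<eta>) * ennreal ((norm (g x))\<^sup>2) + ennreal (1 + 1 / \<eta>) * ennreal ((norm (grad (\<phi> n) x - g x))\<^sup>2) \<partial>lborel)"
    proof (intro nn_integral_mono)
      fix x
      have "(norm (grad (\<phi> n) x))\<^sup>2 \<le> (1 + \<eta>) * (norm (g x))\<^sup>2 + (1 + 1 / \<eta>) * (norm (grad (\<phi> n) x - g x))\<^sup>2"
        using weighted_square_sum_le[OF \<eta>, of "g x" "grad (\<phi> n) x - g x"] by simp
      then have "ennreal ((norm (grad (\<phi> n) x))\<^sup>2) \<le> ennreal ((1 + \<eta>) * (norm (g x))\<^sup>2 + (1 + 1 / \<eta>) * (norm (grad (\<phi> n) x - g x))\<^sup>2)"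
        by (rule ennreal_leI)
      then show "ennreal ((norm (grad (\<phi> n) x))\<^sup>2) \<le> ennreal (1 + \<eta>) * ennreal ((norm (g x))\<^sup>2) + ennreal (1 + 1 / \<eta>) * ennreal ((norm (grad (\<phi> n) x - g x))\<^sup>2)"
        using \<eta> by (simp add: ennreal_mult ennreal_plus)
    qed
    also have "\<dots> = ennreal (1 + \<eta>) * G + ennreal (1 + 1 / \<eta>) * b n"
      unfolding G_def b_def by (subst nn_integral_add) (auto simp: nn_integral_cmult)
    finally show ?thesis by (simp add: add_mono mult_left_mono)
  qed
  \<comment> \<open>For fixed \<eta> and M both approximation errors carry finite constants, so n
    can tend to infinity first. The constant 1 + 1/\<eta> blows up as \<eta> tends to 0, so that
    limit has to come later.\<close>
  have eta: "(\<integral>\<^sup>+ x. ennreal (min (V x) M * (u x)\<^sup>2) \<partial>lborel) \<le> ennreal (1 + \<eta>) * (ennreal (1 + \<eta>) * G)"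
    if \<eta>: "0 < \<eta>" and M: "0 \<le> M" for \<eta> M
  proof (rule LIMSEQ_le_const)
    have "(\<lambda>n. ennreal (1 + \<eta>) * (ennreal (1 + \<eta>) * G + ennreal (1 + 1 / \<eta>) * b n) + ennreal ((1 + 1 / \<eta>) * M) * a n)
       \<longlonglongrightarrow> ennreal (1 + \<eta>) * (ennreal (1 + \<eta>) * G + ennreal (1 + 1 / \<eta>) * 0) + ennreal ((1 + 1 / \<eta>) * M) * 0"
      using limu limg unfolding a_def[symmetric] b_def[symmetric]
      by (intro tendsto_add ennreal_tendsto_cmult tendsto_const) auto
    then show "(\<lambda>n. ennreal (1 + \<eta>) * (ennreal (1 + \<eta>) * G + ennreal (1 + 1 / \<eta>) * b n) + ennreal ((1 + 1 / \<eta>) * M) * a n)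
       \<longlonglongrightarrow> ennreal (1 + \<eta>) * (ennreal (1 + \<eta>) * G)" by simp
  qed (use step[OF that] in auto)
  \<comment> \<open>Young's inequality was used once for the functions and once for the gradients,
    hence the square (1 + \<eta>)^2, here with \<eta> = 1/(n + 1). Finiteness of \<open>G\<close>
    makes multiplication by it continuous.\<close>
  have trunc: "(\<integral>\<^sup>+ x. ennreal (min (V x) M * (u x)\<^sup>2) \<partial>lborel) \<le> G" if M: "0 \<le> M" for M
  proof (cases "G = top")
    case False
    have "(\<lambda>n. G * ennreal ((1 + 1 / real (Suc n))\<^sup>2)) \<longlonglongrightarrow> G * ennreal ((1 + 0)\<^sup>2)"
      using False by (intro ennreal_tendsto_cmult tendsto_ennrealI tendsto_intros LIMSEQ_Suc lim_1_over_n) (auto simp: top.not_eq_extremum)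
    then have "(\<lambda>n. G * ennreal ((1 + 1 / real (Suc n))\<^sup>2)) \<longlonglongrightarrow> G" by simp
    moreover have "(\<integral>\<^sup>+ x. ennreal (min (V x) M * (u x)\<^sup>2) \<partial>lborel) \<le> G * ennreal ((1 + 1 / real (Suc n))\<^sup>2)" for n
      using eta[OF _ M, of "1 / real (Suc n)"] by (simp add: power2_eq_square ennreal_mult mult_ac)
    ultimately show ?thesis by (intro LIMSEQ_le_const) auto
  qed simp
  have "(\<integral>\<^sup>+ x. ennreal (V x * (u x)\<^sup>2) \<partial>lborel) = (\<integral>\<^sup>+ x. (SUP n. ennreal (min (V x) (real n) * (u x)\<^sup>2)) \<partial>lborel)"
  proof (intro nn_integral_cong antisym)
    fix x
    obtain n where "V x \<le> real n" using real_arch_simple by blast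
    then have "ennreal (V x * (u x)\<^sup>2) = ennreal (min (V x) (real n) * (u x)\<^sup>2)" by simp
    also have "\<dots> \<le> (SUP n. ennreal (min (V x) (real n) * (u x)\<^sup>2))" by (rule SUP_upper) simp
    finally show "ennreal (V x * (u x)\<^sup>2) \<le> (SUP n. ennreal (min (V x) (real n) * (u x)\<^sup>2))" .
    show "(SUP n. ennreal (min (V x) (real n) * (u x)\<^sup>2)) \<le> ennreal (V x * (u x)\<^sup>2)"
      by (intro SUP_least ennreal_leI mult_right_mono) auto
  qed
  also have "\<dots> = (SUP n. \<integral>\<^sup>+ x. ennreal (min (V x) (real n) * (u x)\<^sup>2) \<partial>lborel)"
    by (intro nn_integral_monotone_convergence_SUP)
      (auto simp: incseq_def le_fun_def intro!: ennreal_leI mult_right_mono)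
  also have "\<dots> \<le> G" by (intro SUP_least trunc) simp
  finally show ?thesis by (simp add: G_def)
qed

subsection \<open>Twisted polar coordinates\<close>

text \<open>The extreme coordinates of \<open>K\<close> are pushed outwards while staying inside the
  open strip. The strict inequalities keep \<open>K\<close> off the boundary of the rectangle, where
  a function supported in \<open>K\<close> has to vanish for the integration by parts.\<close>

lemma compact_subset_open_rectangle:
  fixes K :: "(real \<times> real) set"
  assumes K: "compact K" "K \<subseteq> {0<..} \<times> {0<..<l}" and l: "0 < l"
  obtains r1 r2 p1 p2 where "0 < r1" "r1 \<le> r2" "0 < p1" "p1 \<le> p2" "p2 < l"
    "\<And>r p. (r, p) \<in> K \<Longrightarrow> r1 < r \<and> r < r2 \<and> p1 < p \<and> p < p2"
proof (cases "K = {}")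
  case True
  with l show ?thesis by (intro that[of 1 1 "l / 2" "l / 2"]) auto
next
  case False
  have c: "compact (fst ` K)" "compact (snd ` K)" "fst ` K \<noteq> {}" "snd ` K \<noteq> {}"
    using K(1) False by (auto intro!: compact_continuous_image continuous_intros)
  from compact_attains_inf[OF c(1,3)] obtain x0 where x0: "x0 \<in> fst ` K" "\<And>x. x \<in> fst ` K \<Longrightarrow> x0 \<le> x" by blast
  from compact_attains_sup[OF c(1,3)] obtain x1 where x1: "x1 \<in> fst ` K" "\<And>x. x \<in> fst ` K \<Longrightarrow> x \<le> x1" by blast
  from compact_attains_inf[OF c(2,4)] obtain y0 where y0: "y0 \<in> snd ` K" "\<And>y. y \<in> snd ` K \<Longrightarrow> y0 \<le> y" by blast
  from compact_attains_sup[OF c(2,4)] obtain y1 where y1: "y1 \<in> snd ` K" "\<And>y. y \<in> snd ` K \<Longrightarrow> y \<le> y1" by blast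
  have pos: "0 < x0" "0 < y0" "y1 < l" "x0 \<le> x1" "y0 \<le> y1"
    using x0 x1 y0 y1 K(2) by auto
  show ?thesis
  proof (rule that[of "x0 / 2" "x1 + 1" "y0 / 2" "(y1 + l) / 2"])
    fix r p assume "(r, p) \<in> K"
    then have "r \<in> fst ` K" "p \<in> snd ` K" by force+
    then have "x0 \<le> r" "r \<le> x1" "y0 \<le> p" "p \<le> y1" by (simp_all add: x0(2) x1(2) y0(2) y1(2))
    with pos show "x0 / 2 < r \<and> r < x1 + 1 \<and> y0 / 2 < p \<and> p < (y1 + l) / 2" by simp
  qed (use pos in auto)
qed

lemma polar_injective:
  fixes r r' \<alpha> \<beta> :: real
  assumes "0 < r" "0 < r'" "r * cos \<alpha> = r' * cos \<beta>" "r * sin \<alpha> = r' * sin \<beta>"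
  shows "r = r'" "\<exists>n::int. \<alpha> = \<beta> + 2 * pi * n"
proof -
  have *: "(x * cos t)\<^sup>2 + (x * sin t)\<^sup>2 = x\<^sup>2" for x t :: real
  proof -
    have "(x * cos t)\<^sup>2 + (x * sin t)\<^sup>2 = x\<^sup>2 * ((sin t)\<^sup>2 + (cos t)\<^sup>2)" by algebra
    then show ?thesis by simp
  qed
  have "r\<^sup>2 = (r * cos \<alpha>)\<^sup>2 + (r * sin \<alpha>)\<^sup>2" by (simp add: *)
  also have "\<dots> = r'\<^sup>2" unfolding assms(3,4) by (simp add: *)
  finally show "r = r'" using assms(1,2) by (simp add: power2_eq_iff_nonneg)
  then show "\<exists>n::int. \<alpha> = \<beta> + 2 * pi * n"
    using assms sin_cos_eq_iff[of \<alpha> \<beta>] by auto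
qed

definition twisted_polar :: "(real \<Rightarrow> real) \<Rightarrow> real \<times> real \<Rightarrow> real \<times> real" where
  "twisted_polar \<theta> z = (fst z * cos (snd z + \<theta> (fst z)), fst z * sin (snd z + \<theta> (fst z)))"

lemma curved_wedge_eq: "curved_wedge a \<theta> = twisted_polar \<theta> ` ({0<..} \<times> {0<..<2 * pi * a})"
  unfolding curved_wedge_def twisted_polar_def by force

lemma norm_twisted_polar: "0 < fst z \<Longrightarrow> norm (twisted_polar \<theta> z) = fst z"
  by (simp add: twisted_polar_def norm_Pair power_mult_distrib flip: distrib_left)

text \<open>Equal images have equal radii, hence equal twists, so the angles differ by a multiple of
  2 \<pi>. With a \<le> 1 the open interval of angles has length at most 2 \<pi>, which forces the
  multiple to be zero.\<close>

lemma inj_on_twisted_polar: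
  assumes "a \<le> 1"
  shows "inj_on (twisted_polar \<theta>) ({0<..} \<times> {0<..<2 * pi * a})"
proof (rule inj_onI, clarsimp simp: twisted_polar_def)
  fix r p r' p'
  assume r: "0 < r" "0 < r'" and p: "0 < p" "p < 2 * pi * a" "0 < p'" "p' < 2 * pi * a"
    and eq: "r * cos (p + \<theta> r) = r' * cos (p' + \<theta> r')" "r * sin (p + \<theta> r) = r' * sin (p' + \<theta> r')"
  note inj = polar_injective[OF r eq]
  then obtain n :: int where n: "p = p' + 2 * pi * n" by auto
  have "2 * pi * a \<le> 2 * pi * 1" using assms by simp
  with n p have "2 * pi * n < 2 * pi * 1" "2 * pi * (- 1) < 2 * pi * n" by linarith+
  then have "real_of_int n < 1" "- 1 < real_of_int n" by (simp_all only: mult_less_cancel_left_pos[of "2 * pi"] pi_gt_zero mult_pos_pos zero_less_numeral)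
  then have "n = 0" by linarith
  with n inj show "r = r' \<and> p = p'" by simp
qed

lemma twisted_polar_has_derivative:
  fixes \<theta> :: "real \<Rightarrow> real"
  assumes "(\<theta> has_real_derivative \<theta>' (fst z)) (at (fst z))"
  defines "\<psi> \<equiv> snd z + \<theta> (fst z)"
  shows "(twisted_polar \<theta> has_derivative (\<lambda>h.
     ((cos \<psi> - fst z * \<theta>' (fst z) * sin \<psi>) * fst h + (- fst z * sin \<psi>) * snd h,
      (sin \<psi> + fst z * \<theta>' (fst z) * cos \<psi>) * fst h + (fst z * cos \<psi>) * snd h))) (at z within D)"
proof -
  have "(fst has_derivative fst) (at z within D)" by (rule bounded_linear_imp_has_derivative[OF bounded_linear_fst])
  moreover have "(\<theta> has_derivative (\<lambda>h. \<theta>' (fst z) * h)) (at (fst z))"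
    using assms by (simp add: has_field_derivative_def)
  ultimately have [derivative_intros]: "((\<lambda>z. \<theta> (fst z)) has_derivative (\<lambda>h. \<theta>' (fst z) * fst h)) (at z within D)"
    by (rule has_derivative_compose)
  show ?thesis unfolding twisted_polar_def[abs_def] \<psi>_def
    by (auto intro!: derivative_eq_intros simp: fun_eq_iff algebra_simps)
qed

lemma grad_pair: "grad u x = (pderiv_dir (1, 0) u x, pderiv_dir (0, 1) u x)"
  for u :: "real \<times> real \<Rightarrow> real"
  unfolding grad_def pderiv_dir_def Basis_prod_def
  by (subst sum.union_disjoint) auto

lemma test_fun_has_derivative_pair:
  fixes u :: "real \<times> real \<Rightarrow> real"
  assumes "test_fun \<Omega> u"
  shows "(u has_derivative (\<lambda>h. fst h * pderiv_dir (1, 0) u x + snd h * pderiv_dir (0, 1) u x)) (at x)"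
proof -
  have D: "(u has_derivative frechet_derivative u (at x)) (at x)"
    using test_fun_differentiable(1)[OF assms] by (simp add: frechet_derivative_works)
  interpret linear "frechet_derivative u (at x)"
    using D by (rule has_derivative_linear)
  have "frechet_derivative u (at x) = (\<lambda>h. fst h * pderiv_dir (1, 0) u x + snd h * pderiv_dir (0, 1) u x)"
  proof
    fix h :: "real \<times> real"
    have "h = fst h *\<^sub>R (1, 0) + snd h *\<^sub>R (0, 1)" by (cases h) simp
    then have "frechet_derivative u (at x) h = frechet_derivative u (at x) (fst h *\<^sub>R (1, 0) + snd h *\<^sub>R (0, 1))" by simp
    then show "frechet_derivative u (at x) h = fst h * pderiv_dir (1, 0) u x + snd h * pderiv_dir (0, 1) u x"
      unfolding add scale by (simp add: pderiv_dir_def)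
  qed
  with D show ?thesis by simp
qed

lemma nn_integral_continuous_cbox:
  fixes f :: "'a::euclidean_space \<Rightarrow> real"
  assumes "continuous_on (cbox a b) f" "\<And>x. x \<in> cbox a b \<Longrightarrow> 0 \<le> f x"
  shows "(\<integral>\<^sup>+ x\<in>cbox a b. ennreal (f x) \<partial>lborel) = ennreal (integral (cbox a b) f)"
  by (rule nn_integral_has_integral_lebesgue'[OF assms(2) integrable_integral[OF integrable_continuous[OF assms(1)]]])

lemma test_fun_wedge_hardy:
  fixes a :: real and \<theta> \<theta>' :: "real \<Rightarrow> real"
  assumes a: "0 < a" "a \<le> 1"
    and d\<theta>: "\<And>r. 0 \<le> r \<Longrightarrow> (\<theta> has_real_derivative \<theta>' r) (at r within {0..})"
    and c\<theta>': "continuous_on {0..} \<theta>'" and nz: "\<exists>r\<ge>0. \<theta>' r \<noteq> 0"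
  obtains c where "0 < c"
    "\<And>u. test_fun (curved_wedge a \<theta>) u \<Longrightarrow>
      (\<integral>\<^sup>+ x. ennreal (((1 / (2 * a))\<^sup>2 / (norm x)\<^sup>2 + c / (1 + (norm x)\<^sup>2 * (ln (norm x))\<^sup>2)) * (u x)\<^sup>2) \<partial>lborel)
      \<le> (\<integral>\<^sup>+ x. ennreal ((norm (grad u x))\<^sup>2) \<partial>lborel)"
proof -
  define k where "k = 1 / (2 * a)"
  have k: "0 < k" using a by (simp add: k_def)
  show ?thesis
  proof (rule calibrating_field[OF c\<theta>' nz k])
    fix c f1 f1r f1p f2 f2p assume c: "0 < c"
      and df: "\<And>r p. 0 < r \<Longrightarrow> ((\<lambda>r. f1 r p) has_real_derivative f1r r p) (at r)"
      "\<And>r p. 0 < r \<Longrightarrow> (f1 r has_real_derivative f1p r p) (at p)"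
      "\<And>r p. 0 < r \<Longrightarrow> sin (k * p) \<noteq> 0 \<Longrightarrow> (f2 r has_real_derivative f2p r p) (at p)"
      and cf: "continuous_on ({0<..} \<times> UNIV) (\<lambda>(r, p). f1 r p)"
      "continuous_on ({0<..} \<times> UNIV) (\<lambda>(r, p). f1r r p)"
      "continuous_on ({0<..} \<times> UNIV) (\<lambda>(r, p). f1p r p)"
      "continuous_on ({0<..} \<times> {p. sin (k * p) \<noteq> 0}) (\<lambda>(r, p). f2 r p)"
      "continuous_on ({0<..} \<times> {p. sin (k * p) \<noteq> 0}) (\<lambda>(r, p). f2p r p)"
      and ric: "\<And>r p. 0 < r \<Longrightarrow> sin (k * p) \<noteq> 0 \<Longrightarrow>
         k\<^sup>2 + c * (r\<^sup>2 / (1 + r\<^sup>2 * (ln r)\<^sup>2))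
         \<le> r * f1r r p - r * \<theta>' r * f1p r p + f2p r p - (f1 r p)\<^sup>2 - (f2 r p)\<^sup>2"
    define W where "W r = 1 + r\<^sup>2 * (ln r)\<^sup>2" for r :: real
    have W: "0 < W r" for r by (simp add: W_def add_pos_nonneg)
    define V where "V x = k\<^sup>2 / (norm x)\<^sup>2 + c / W (norm x)" for x :: "real \<times> real"
    have V0: "0 \<le> V x" for x using c W[of "norm x"] by (simp add: V_def)
    define U where "U = {0::real<..} \<times> {0<..<2 * pi * a}"
    have d\<theta>1: "(\<theta> has_real_derivative \<theta>' r) (at r)" if "0 < r" for r
    proof -
      have "(\<theta> has_real_derivative \<theta>' r) (at r within {0<..})"
        by (rule DERIV_subset[OF d\<theta>]) (use that in auto)
      then show ?thesis by (simp only: at_within_open[of r "{0<..}"] open_greaterThan greaterThan_iff that)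
    qed
    have c\<theta>: "continuous_on {0<..} \<theta>"
      by (rule DERIV_continuous_on[where D = \<theta>', OF has_field_derivative_at_within[OF d\<theta>1]]) simp
    note dT = twisted_polar_has_derivative[where \<theta> = \<theta> and \<theta>' = \<theta>', OF d\<theta>1]
    have cT: "continuous_on S (twisted_polar \<theta>)" if "S \<subseteq> U" for S
      by (rule has_derivative_continuous_on, rule dT) (use that in \<open>auto simp: U_def\<close>)
    have inj: "inj_on (twisted_polar \<theta>) U" unfolding U_def by (rule inj_on_twisted_polar[OF a(2)])
    have "open U" by (simp add: U_def open_Times)
    \<comment> \<open>Invariance of domain turns a continuous injection of an open set into a
      homeomorphism. The continuous inverse makes the preimage of the support of a test function
      compact, hence enclosed in a rectangle.\<close>
    then obtain h where h: "homeomorphism U (twisted_polar \<theta> ` U) (twisted_polar \<theta>) h"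
      using invariance_of_domain_homeomorphism[OF _ cT[OF subset_refl] _ inj] by auto
    have "(\<integral>\<^sup>+ x. ennreal (V x * (u x)\<^sup>2) \<partial>lborel) \<le> (\<integral>\<^sup>+ x. ennreal ((norm (grad u x))\<^sup>2) \<partial>lborel)"
      if u: "test_fun (curved_wedge a \<theta>) u" for u
    proof -
      have K: "compact (tsupport u)" "tsupport u \<subseteq> twisted_polar \<theta> ` U"
        using u by (auto simp: test_fun_def curved_wedge_eq U_def)
      have hK: "compact (h ` tsupport u)"
        by (intro compact_continuous_image K(1) continuous_on_subset[OF homeomorphism_cont2[OF h] K(2)])
      have hU: "h ` tsupport u \<subseteq> {0<..} \<times> {0<..<2 * pi * a}"
        using image_mono[OF K(2), of h] unfolding homeomorphism_image2[OF h] unfolding U_def .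
      have "0 < 2 * pi * a" using a by simp
      then obtain r1 r2 p1 p2 where rp: "0 < r1" "r1 \<le> r2" "0 < p1" "p1 \<le> p2" "p2 < 2 * pi * a"
        and supp: "\<And>r p. (r, p) \<in> h ` tsupport u \<Longrightarrow> r1 < r \<and> r < r2 \<and> p1 < p \<and> p < p2"
        using compact_subset_open_rectangle[OF hK hU] by blast
      define D where "D = cbox (r1, p1) (r2, p2)"
      have D: "z \<in> D \<longleftrightarrow> r1 \<le> fst z \<and> fst z \<le> r2 \<and> p1 \<le> snd z \<and> snd z \<le> p2" for z
        by (cases z) (auto simp: D_def cbox_Pair_eq)
      have DU: "D \<subseteq> U" using rp by (auto simp: D U_def)
      \<comment> \<open>The opening angle 2 \<pi> a equals \<pi> / k, so k p stays strictly between
        0 and \<pi> and the cotangent is continuous on the rectangle.\<close>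
      have sin0: "sin (k * p) \<noteq> 0" if "p1 \<le> p" "p \<le> p2" for p
      proof -
        have "0 < k * p" "k * p < pi" using that rp a by (auto simp: k_def field_simps)
        then show ?thesis using sin_gt_zero[of "k * p"] by simp
      qed
      have uz: "u x = 0" if "x \<notin> twisted_polar \<theta> ` {z \<in> D. r1 < fst z \<and> fst z < r2 \<and> p1 < snd z \<and> snd z < p2}" for x
      proof (rule ccontr)
        assume "u x \<noteq> 0"
        then have x: "x \<in> tsupport u" by (auto simp: tsupport_def intro: closure_subset[THEN subsetD])
        then have "twisted_polar \<theta> (h x) = x" using K(2) by (intro homeomorphism_apply2[OF h]) (rule subsetD)
        moreover have "r1 < fst (h x) \<and> fst (h x) < r2 \<and> p1 < snd (h x) \<and> snd (h x) < p2"
          using supp[of "fst (h x)" "snd (h x)"] x by simp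
        ultimately show False using that by (force simp: D)
      qed
      \<comment> \<open>Injectivity is essential here: it prevents a boundary point of the rectangle
        from having the same image as an interior point, where u may be nonzero.\<close>
      have uz': "u (twisted_polar \<theta> z) = 0"
        if "z \<in> D" "\<not> (r1 < fst z \<and> fst z < r2 \<and> p1 < snd z \<and> snd z < p2)" for z
      proof (rule uz, rule notI)
        assume "twisted_polar \<theta> z \<in> twisted_polar \<theta> ` {z \<in> D. r1 < fst z \<and> fst z < r2 \<and> p1 < snd z \<and> snd z < p2}"
        then obtain z' where "z' \<in> D" "r1 < fst z' \<and> fst z' < r2 \<and> p1 < snd z' \<and> snd z' < p2"
          "twisted_polar \<theta> z = twisted_polar \<theta> z'" by auto
        with that show False using inj DU by (metis inj_onD subsetD)
      qed
      have chg: "(\<integral>\<^sup>+ x\<in>twisted_polar \<theta> ` D. ennreal (f x) \<partial>lborel) = ennreal (integral D (\<lambda>z. fst z * f (twisted_polar \<theta> z)))"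
        if f: "continuous_on (twisted_polar \<theta> ` D) f" "\<And>x. 0 \<le> f x" for f
      proof -
        \<comment> \<open>The twist is a shear of the polar coordinates, so \<theta>' cancels and
          the Jacobian is r, as for ordinary polar coordinates.\<close>
        have det: "(cos \<psi> - r * t * sin \<psi>) * (r * cos \<psi>) - (- r * sin \<psi>) * (sin \<psi> + r * t * cos \<psi>) = r" for r t \<psi> :: real
        proof -
          have "(cos \<psi> - r * t * sin \<psi>) * (r * cos \<psi>) - (- r * sin \<psi>) * (sin \<psi> + r * t * cos \<psi>) = r * ((sin \<psi>)\<^sup>2 + (cos \<psi>)\<^sup>2)"
            by algebra
          then show ?thesis by simp
        qed
        have "(\<integral>\<^sup>+ x\<in>twisted_polar \<theta> ` D. ennreal (f x) \<partial>lborel) = (\<integral>\<^sup>+ z\<in>D. ennreal (\<bar>fst z\<bar> * f (twisted_polar \<theta> z)) \<partial>lborel)"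
          by (rule nn_integral_change_of_variables_pair[where g = "twisted_polar \<theta>", OF _ dT inj_on_subset[OF inj DU] f, unfolded det])
            (use rp in \<open>auto simp: D_def[symmetric] D intro!: continuous_intros\<close>, simp add: D_def)
        also have "\<dots> = (\<integral>\<^sup>+ z\<in>D. ennreal (fst z * f (twisted_polar \<theta> z)) \<partial>lborel)"
          using rp by (intro nn_integral_cong) (auto simp: D indicator_def)
        also have "\<dots> = ennreal (integral D (\<lambda>z. fst z * f (twisted_polar \<theta> z)))"
          unfolding D_def
        proof (rule nn_integral_continuous_cbox)
          show "continuous_on (cbox (r1, p1) (r2, p2)) (\<lambda>z. fst z * f (twisted_polar \<theta> z))"
            unfolding D_def[symmetric]
            by (intro continuous_intros continuous_on_compose2[OF f(1) cT[OF DU]]) auto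
        qed (use rp f in \<open>auto simp: D_def[symmetric] D\<close>)
        finally show ?thesis .
      qed
      define \<psi> where "\<psi> r p = p + \<theta> r" for r p
      define ux where "ux r p = pderiv_dir (1, 0) u (twisted_polar \<theta> (r, p))" for r p
      define uy where "uy r p = pderiv_dir (0, 1) u (twisted_polar \<theta> (r, p))" for r p
      define v where "v r p = u (twisted_polar \<theta> (r, p))" for r p
      define vr where "vr r p = (cos (\<psi> r p) - r * \<theta>' r * sin (\<psi> r p)) * ux r p + (sin (\<psi> r p) + r * \<theta>' r * cos (\<psi> r p)) * uy r p" for r p
      define vp where "vp r p = (- r * sin (\<psi> r p)) * ux r p + (r * cos (\<psi> r p)) * uy r p" for r p
      have dv: "((\<lambda>z. u (twisted_polar \<theta> z)) has_derivative (\<lambda>h. vr r p * fst h + vp r p * snd h)) (at (r, p))" if "0 < r" for r p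
      proof -
        have "((\<lambda>z. u (twisted_polar \<theta> z)) has_derivative (\<lambda>h.
            ((cos (\<psi> r p) - r * \<theta>' r * sin (\<psi> r p)) * fst h + (- r * sin (\<psi> r p)) * snd h) * ux r p
            + ((sin (\<psi> r p) + r * \<theta>' r * cos (\<psi> r p)) * fst h + (r * cos (\<psi> r p)) * snd h) * uy r p)) (at (r, p))"
          using has_derivative_compose[OF dT[of "(r, p)"] test_fun_has_derivative_pair[OF u]] that
          by (simp add: \<psi>_def ux_def uy_def)
        then show ?thesis by (rule has_derivative_eq_rhs) (simp add: fun_eq_iff vr_def vp_def algebra_simps)
      qed
      have dvr: "((\<lambda>r. v r p) has_real_derivative vr r p) (at r)" if "0 < r" for r p
      proof -
        have "((\<lambda>r. (r, p)) has_derivative (\<lambda>h. (h, 0))) (at r)" by (auto intro!: derivative_eq_intros)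
        from has_derivative_compose[OF this dv[OF that]]
        show ?thesis by (simp add: v_def[abs_def] has_field_derivative_def)
      qed
      have dvp: "(v r has_real_derivative vp r p) (at p)" if "0 < r" for r p
      proof -
        have "((\<lambda>p. (r, p)) has_derivative (\<lambda>h. (0, h))) (at p)" by (auto intro!: derivative_eq_intros)
        from has_derivative_compose[OF this dv[OF that]]
        show ?thesis by (simp add: v_def[abs_def] has_field_derivative_def)
      qed
      have cux: "continuous_on D (\<lambda>z. ux (fst z) (snd z))" "continuous_on D (\<lambda>z. uy (fst z) (snd z))"
        "continuous_on D (\<lambda>z. v (fst z) (snd z))"
        unfolding ux_def uy_def v_def
        by (auto intro!: continuous_on_compose2[OF continuous_pderiv_dir[OF u] cT[OF DU]]
            continuous_on_compose2[OF continuous_test_fun[OF u] cT[OF DU]] simp: Basis_prod_def)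
      have c\<psi>: "continuous_on D (\<lambda>z. \<psi> (fst z) (snd z))" "continuous_on D (\<lambda>z. \<theta>' (fst z))"
        unfolding \<psi>_def using rp
        by (auto intro!: continuous_intros continuous_on_compose2[OF c\<theta>] continuous_on_compose2[OF c\<theta>'] simp: D)
      \<comment> \<open>Subtracting \<theta>' vp undoes the shear. What results are the components
        of the gradient in the radial and tangential orthonormal frame, a rotation of the Cartesian
        one.\<close>
      have grad: "(vr r p - \<theta>' r * vp r p)\<^sup>2 + (vp r p / r)\<^sup>2 = (norm (grad u (twisted_polar \<theta> (r, p))))\<^sup>2" if "0 < r" for r p
      proof -
        have 1: "vr r p - \<theta>' r * vp r p = cos (\<psi> r p) * ux r p + sin (\<psi> r p) * uy r p"
          unfolding vr_def vp_def by (simp add: algebra_simps)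
        have 2: "vp r p / r = cos (\<psi> r p) * uy r p - sin (\<psi> r p) * ux r p"
          unfolding vp_def using that by (simp add: field_simps)
        have "(vr r p - \<theta>' r * vp r p)\<^sup>2 + (vp r p / r)\<^sup>2 = ((sin (\<psi> r p))\<^sup>2 + (cos (\<psi> r p))\<^sup>2) * ((ux r p)\<^sup>2 + (uy r p)\<^sup>2)"
          unfolding 1 2 by algebra
        then show ?thesis by (simp add: grad_pair norm_Pair ux_def uy_def)
      qed
      have main: "integral D (\<lambda>(r, p). r * ((k\<^sup>2 / r\<^sup>2 + c / W r) * (v r p)\<^sup>2))
         \<le> integral D (\<lambda>(r, p). r * ((vr r p - \<theta>' r * vp r p)\<^sup>2 + (vp r p / r)\<^sup>2))"
        unfolding D_def
      proof (rule rectangle_hardy[where ?f1.0 = f1 and f1r = f1r and f1p = f1p and ?f2.0 = f2 and f2p = f2p])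
        show "continuous_on (cbox (r1, p1) (r2, p2)) (\<lambda>(r, p). v r p)" "continuous_on (cbox (r1, p1) (r2, p2)) (\<lambda>(r, p). vr r p)"
          "continuous_on (cbox (r1, p1) (r2, p2)) (\<lambda>(r, p). vp r p)"
          unfolding D_def[symmetric] case_prod_unfold vr_def vp_def
          by (intro continuous_intros cux c\<psi>)+
        show "continuous_on (cbox (r1, p1) (r2, p2)) (\<lambda>(r, p). f1 r p)" "continuous_on (cbox (r1, p1) (r2, p2)) (\<lambda>(r, p). f1r r p)"
          "continuous_on (cbox (r1, p1) (r2, p2)) (\<lambda>(r, p). f1p r p)" "continuous_on (cbox (r1, p1) (r2, p2)) (\<lambda>(r, p). f2 r p)"
          "continuous_on (cbox (r1, p1) (r2, p2)) (\<lambda>(r, p). f2p r p)"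
          unfolding D_def[symmetric]
          by (rule continuous_on_subset[OF cf(1)] continuous_on_subset[OF cf(2)] continuous_on_subset[OF cf(3)]
              continuous_on_subset[OF cf(4)] continuous_on_subset[OF cf(5)]; use rp sin0 in \<open>auto simp: D\<close>)+
        show "continuous_on {r1..r2} \<theta>'" by (rule continuous_on_subset[OF c\<theta>']) (use rp in auto)
        show "continuous_on {r1..r2} W" unfolding W_def[abs_def] using rp by (intro continuous_intros) auto
        show "W r \<noteq> 0" for r using W[of r] by simp
        show "v r1 p = 0 \<and> v r2 p = 0" if "p1 \<le> p" "p \<le> p2" for p
          unfolding v_def using that rp uz'[of "(r1, p)"] uz'[of "(r2, p)"] by (auto simp: D)
        show "v r p1 = 0 \<and> v r p2 = 0" if "r1 \<le> r" "r \<le> r2" for r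
          unfolding v_def using that rp uz'[of "(r, p1)"] uz'[of "(r, p2)"] by (auto simp: D)
        show "k\<^sup>2 + c * (r\<^sup>2 / W r)
          \<le> r * f1r r p - r * \<theta>' r * f1p r p + f2p r p - (f1 r p)\<^sup>2 - (f2 r p)\<^sup>2"
          if "r1 \<le> r" "r \<le> r2" "p1 \<le> p" "p \<le> p2" for r p
          unfolding W_def by (rule ric) (use that rp sin0 in auto)
      qed (use rp sin0 in \<open>auto intro!: df dvr dvp\<close>)
      have "(\<integral>\<^sup>+ x. ennreal (V x * (u x)\<^sup>2) \<partial>lborel) = (\<integral>\<^sup>+ x\<in>twisted_polar \<theta> ` D. ennreal (V x * (u x)\<^sup>2) \<partial>lborel)"
        by (intro nn_integral_cong) (use uz in \<open>fastforce simp: indicator_def\<close>)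
      also have "\<dots> = ennreal (integral D (\<lambda>z. fst z * (V (twisted_polar \<theta> z) * (u (twisted_polar \<theta> z))\<^sup>2)))"
      proof (rule chg)
        have "x \<noteq> 0" if x: "x \<in> twisted_polar \<theta> ` D" for x
        proof -
          obtain z where "x = twisted_polar \<theta> z" "z \<in> D" using x by blast
          then have "norm x = fst z" "0 < fst z" using norm_twisted_polar[of z \<theta>] rp by (auto simp: D)
          then show ?thesis by auto
        qed
        then show "continuous_on (twisted_polar \<theta> ` D) (\<lambda>x. V x * (u x)\<^sup>2)"
          unfolding V_def W_def using W[unfolded W_def, THEN less_imp_neq]
          by (intro continuous_intros continuous_test_fun[OF u]) (auto dest: not_sym)
      qed (simp add: V0)
      also have "integral D (\<lambda>z. fst z * (V (twisted_polar \<theta> z) * (u (twisted_polar \<theta> z))\<^sup>2))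
          = integral D (\<lambda>(r, p). r * ((k\<^sup>2 / r\<^sup>2 + c / W r) * (v r p)\<^sup>2))"
        using rp by (intro integral_cong) (auto simp: D V_def v_def norm_twisted_polar)
      also have "ennreal \<dots> \<le> ennreal (integral D (\<lambda>(r, p). r * ((vr r p - \<theta>' r * vp r p)\<^sup>2 + (vp r p / r)\<^sup>2)))"
        by (rule ennreal_leI[OF main])
      also have "integral D (\<lambda>(r, p). r * ((vr r p - \<theta>' r * vp r p)\<^sup>2 + (vp r p / r)\<^sup>2))
          = integral D (\<lambda>z. fst z * (norm (grad u (twisted_polar \<theta> z)))\<^sup>2)"
        using rp by (intro integral_cong) (auto simp: D grad)
      also have "ennreal \<dots> = (\<integral>\<^sup>+ x\<in>twisted_polar \<theta> ` D. ennreal ((norm (grad u x))\<^sup>2) \<partial>lborel)"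
        by (rule chg[symmetric]) (auto intro!: continuous_intros continuous_grad[OF u])
      also have "\<dots> \<le> (\<integral>\<^sup>+ x. ennreal ((norm (grad u x))\<^sup>2) \<partial>lborel)"
        by (intro nn_integral_mono) (auto simp: indicator_def)
      finally show ?thesis .
    qed
    with c show ?thesis by (intro that[of c]) (auto simp: V_def W_def k_def)
  qed
qed

theorem theorem1p3:
  fixes a :: real and \<theta> \<theta>' :: "real \<Rightarrow> real"
  assumes "0 < a" "a \<le> 1"
    and "\<And>r. r \<ge> 0 \<Longrightarrow> (\<theta> has_real_derivative \<theta>' r) (at r within {0..})"
    and "continuous_on {0..} \<theta>'"
    and "compact (closure {r. r \<ge> 0 \<and> \<theta>' r \<noteq> 0})"
    and "\<exists>r\<ge>0. \<theta>' r \<noteq> 0"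
  shows "\<exists>c>0. \<forall>u g. H01 (curved_wedge a \<theta>) u g \<longrightarrow>
     (\<integral>\<^sup>+ x. ennreal ((norm (g x))\<^sup>2) \<partial>lborel) \<ge>
       (\<integral>\<^sup>+ x\<in>curved_wedge a \<theta>. ennreal (1 / (4 * a\<^sup>2) * (u x)\<^sup>2 / (norm x)\<^sup>2) \<partial>lborel)
       + ennreal c * (\<integral>\<^sup>+ x\<in>curved_wedge a \<theta>.
            ennreal ((u x)\<^sup>2 / (1 + (norm x)\<^sup>2 * (ln (norm x))\<^sup>2)) \<partial>lborel)"
proof -
  obtain c where c: "0 < c" and test: "\<And>u. test_fun (curved_wedge a \<theta>) u \<Longrightarrow>
      (\<integral>\<^sup>+ x. ennreal (((1 / (2 * a))\<^sup>2 / (norm x)\<^sup>2 + c / (1 + (norm x)\<^sup>2 * (ln (norm x))\<^sup>2)) * (u x)\<^sup>2) \<partial>lborel)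
      \<le> (\<integral>\<^sup>+ x. ennreal ((norm (grad u x))\<^sup>2) \<partial>lborel)"
    using test_fun_wedge_hardy[OF assms(1-4,6)] by blast
  \<comment> \<open>This is the Hardy weight k^2 / \<bar>x\<bar>^2 with k = 1/(2 a).\<close>
  define P where "P x = 1 / (4 * a\<^sup>2) / (norm x)\<^sup>2" for x :: "real \<times> real"
  define W where "W x = 1 + (norm x)\<^sup>2 * (ln (norm x))\<^sup>2" for x :: "real \<times> real"
  have W: "0 < W x" for x by (simp add: W_def add_pos_nonneg)
  have P: "0 \<le> P x" for x by (simp add: P_def)
  have [measurable]: "P \<in> borel_measurable borel" "W \<in> borel_measurable borel"
    unfolding P_def[abs_def] W_def[abs_def] by measurable
  have "(\<integral>\<^sup>+ x\<in>curved_wedge a \<theta>. ennreal (1 / (4 * a\<^sup>2) * (u x)\<^sup>2 / (norm x)\<^sup>2) \<partial>lborel)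
       + ennreal c * (\<integral>\<^sup>+ x\<in>curved_wedge a \<theta>. ennreal ((u x)\<^sup>2 / (1 + (norm x)\<^sup>2 * (ln (norm x))\<^sup>2)) \<partial>lborel)
     \<le> (\<integral>\<^sup>+ x. ennreal ((norm (g x))\<^sup>2) \<partial>lborel)" if H: "H01 (curved_wedge a \<theta>) u g" for u g
  proof -
    have [measurable]: "u \<in> borel_measurable borel" using H by (simp add: H01_def)
    \<comment> \<open>Both integrals are enlarged to the whole plane, where the weighted bound is
      available. This keeps the indicator of the wedge out of the measurability conditions when they
      are merged into one integral.\<close>
    have "(\<integral>\<^sup>+ x\<in>curved_wedge a \<theta>. ennreal (1 / (4 * a\<^sup>2) * (u x)\<^sup>2 / (norm x)\<^sup>2) \<partial>lborel)
       \<le> (\<integral>\<^sup>+ x. ennreal (P x * (u x)\<^sup>2) \<partial>lborel)"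
      by (intro nn_integral_mono) (simp add: P_def indicator_def)
    moreover have "(\<integral>\<^sup>+ x\<in>curved_wedge a \<theta>. ennreal ((u x)\<^sup>2 / (1 + (norm x)\<^sup>2 * (ln (norm x))\<^sup>2)) \<partial>lborel)
       \<le> (\<integral>\<^sup>+ x. ennreal ((u x)\<^sup>2 / W x) \<partial>lborel)"
      by (intro nn_integral_mono) (simp add: W_def indicator_def)
    ultimately have "(\<integral>\<^sup>+ x\<in>curved_wedge a \<theta>. ennreal (1 / (4 * a\<^sup>2) * (u x)\<^sup>2 / (norm x)\<^sup>2) \<partial>lborel)
       + ennreal c * (\<integral>\<^sup>+ x\<in>curved_wedge a \<theta>. ennreal ((u x)\<^sup>2 / (1 + (norm x)\<^sup>2 * (ln (norm x))\<^sup>2)) \<partial>lborel)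
       \<le> (\<integral>\<^sup>+ x. ennreal (P x * (u x)\<^sup>2) \<partial>lborel) + ennreal c * (\<integral>\<^sup>+ x. ennreal ((u x)\<^sup>2 / W x) \<partial>lborel)"
      by (intro add_mono mult_left_mono) auto
    also have "\<dots> = (\<integral>\<^sup>+ x. ennreal (P x * (u x)\<^sup>2) + ennreal c * ennreal ((u x)\<^sup>2 / W x) \<partial>lborel)"
      by (subst nn_integral_add) (auto simp: nn_integral_cmult)
    also have "\<dots> = (\<integral>\<^sup>+ x. ennreal ((P x + c / W x) * (u x)\<^sup>2) \<partial>lborel)"
    proof (intro nn_integral_cong)
      fix x
      have "ennreal (P x * (u x)\<^sup>2) + ennreal c * ennreal ((u x)\<^sup>2 / W x) = ennreal (P x * (u x)\<^sup>2 + c * ((u x)\<^sup>2 / W x))"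
        using P[of x] W[of x] c by (simp add: ennreal_mult[symmetric] ennreal_plus[symmetric] del: ennreal_plus)
      also have "P x * (u x)\<^sup>2 + c * ((u x)\<^sup>2 / W x) = (P x + c / W x) * (u x)\<^sup>2"
        by (simp add: distrib_right)
      finally show "ennreal (P x * (u x)\<^sup>2) + ennreal c * ennreal ((u x)\<^sup>2 / W x) = ennreal ((P x + c / W x) * (u x)\<^sup>2)" .
    qed
    also have "\<dots> \<le> (\<integral>\<^sup>+ x. ennreal ((norm (g x))\<^sup>2) \<partial>lborel)"
    proof (rule H01_weighted_bound[OF H])
      show "0 \<le> P x + c / W x" for x using P[of x] W[of x] c by simp
      show "(\<integral>\<^sup>+ x. ennreal ((P x + c / W x) * (\<phi> x)\<^sup>2) \<partial>lborel) \<le> (\<integral>\<^sup>+ x. ennreal ((norm (grad \<phi> x))\<^sup>2) \<partial>lborel)"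
        if "test_fun (curved_wedge a \<theta>) \<phi>" for \<phi>
        using test[OF that] by (simp add: P_def W_def power_divide power_mult_distrib)
    qed measurable
    finally show ?thesis .
  qed
  with c show ?thesis by blast
qed

end
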